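(* Let $m,n$ be integers with $0\le m\le n$ and $n\ge 1$. Then there is a polynomial $P_1(x;m,n)$ in $x$ of degree at most $\lfloor m/2\rfloor$ such that for all nonnegative integers $x$, $$D(x,x+m;n)=\prod_{i=1}^{n-1}\frac{(2x+m+i)!\,(3x+m+2i+2)_i\,(3x+2m+2i+2)_i}{(x+2i)!\,(x+m+2i)!}\cdot\frac{(2x+m)!}{(x+\lfloor m/2\rfloor)!\,(x+m)!}\cdot\prod_{i=0}^{\lfloor n/2\rfloor-1}\big(2x+2\lceil m/2\rceil+2i+1\big)\cdot P_1(x;m,n).$$ Moreover, if $n$ is odd and $m$ is even, then $P_1(x;m,n)$ is divisible by $2x+m+n$.
   Context: For integers $x,y$ and $n\ge1$, $D(x,y;n):=\det_{0\le i,j\le n-1}\Big(\sum_{x+2i-j<r\le y+2j-i}\binom{x+y+i+j}{r}\Big)$, where sums are signed sums: $\sum_{A<r\le B}\mathrm{Expr}(r)$ equals $\sum_{r=A+1}^{B}\mathrm{Expr}(r)$ if $A<B$, $0$ if $A=B$, and $-\sum_{r=B+1}^{A}\mathrm{Expr}(r)$ if $A>B$. Binomial coefficients $\binom{N}{k}$ vanish for $k<0$ or $k>N$. $(a)_k:=a(a+1)\cdots(a+k-1)$ for $k\ge1$ and $(a)_0:=1$. *)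

theory Defs
  imports "Jordan_Normal_Form.Determinant" "HOL-Computational_Algebra.Polynomial"
begin

definition ssum :: "int \<Rightarrow> int \<Rightarrow> (int \<Rightarrow> int) \<Rightarrow> int" where
  "ssum A B f = (if A < B then (\<Sum>r\<in>{A+1..B}. f r)
                 else if A = B then 0 else - (\<Sum>r\<in>{B+1..A}. f r))"

definition ibinom :: "int \<Rightarrow> int \<Rightarrow> int" where
  "ibinom N k = (if 0 \<le> k \<and> k \<le> N then int (nat N choose nat k) else 0)"

definition Dmat :: "int \<Rightarrow> int \<Rightarrow> nat \<Rightarrow> int mat" where
  "Dmat x y n = mat n n (\<lambda>(i,j).
     ssum (x + 2 * int i - int j) (y + 2 * int j - int i)
          (\<lambda>r. ibinom (x + y + int i + int j) r))"

definition D :: "int \<Rightarrow> int \<Rightarrow> nat \<Rightarrow> int" where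
  "D x y n = det (Dmat x y n)"

end

theory Submission
  imports Defs "Jordan_Normal_Form.Char_Poly"
begin

text \<open>Column operations turn the matrix of \<open>D(x,y;n)\<close> into one whose columns, except for the first, are
  multiples of \<open>(x+y+i+j+1)! / ((x+2i-j)! (y+2j-i+2)!)\<close>. Minors of the latter kind are products, by
  induction with the Desnanot--Jacobi identity. The same identity for the reduced matrix
  therefore gives a two-term recurrence expressing \<open>D(x,y;n+1)\<close> by \<open>D(x,y;n)\<close> and \<open>D(x+2,y-1;n)\<close>. Divide
  by the expected product \<open>W(x,y;n)\<close> and call the quotient \<open>R\<^sub>n(x,y)\<close>; then the recurrence has polynomial
  coefficients, but determines \<open>R\<^sub>n\<^sub>+\<^sub>1(x,y)\<close> only up to division by \<open>2x+y+2n+2\<close>. Interchanging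
  \<open>x\<close> and \<open>y\<close> (where \<open>R\<^sub>n\<close> picks up the sign \<open>(-1)\<^sup>n\<close>) gives a second recurrence, whose linear factor is \<open>x+2y+2n+2\<close>.
  The difference of the two factors is the constant \<open>m = y-x\<close>, so for \<open>m > 0\<close> subtracting the recurrences shows
  that \<open>(x+m)! R\<^sub>n\<^sub>+\<^sub>1(x,x+m)\<close> is a polynomial in \<open>x\<close>; the case \<open>m = 0\<close> and the degree bound follow
  from an induction that also controls the coefficients of the top degree.\<close>

subsection \<open>The Desnanot--Jacobi identity\<close>

text \<open>Entries are given by a function of all pairs of naturals, so that minors of consecutive
  rows and columns are again of the form \<open>dt\<close>, with shifted arguments or a smaller
  size.\<close>

definition dt :: "nat \<Rightarrow> (nat \<Rightarrow> nat \<Rightarrow> 'a) \<Rightarrow> 'a :: comm_ring_1" where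
  "dt n f = det (mat n n (\<lambda>(i,j). f i j))"

lemma dt_0 [simp]: "dt 0 f = 1"
  by (simp add: dt_def)

lemma dt_1 [simp]: "dt (Suc 0) f = f 0 0"
  by (simp add: dt_def det_single)

lemma dt_cong: "(\<And>i j. i < n \<Longrightarrow> j < n \<Longrightarrow> f i j = g i j) \<Longrightarrow> dt n f = dt n g"
  unfolding dt_def by (rule arg_cong[of _ _ det], rule eq_matI) auto

lemma dt_transpose: "dt n (\<lambda>i j. f j i) = dt n f"
proof -
  have "mat n n (\<lambda>(i,j). f j i) = transpose_mat (mat n n (\<lambda>(i,j). f i j))"
    by (rule eq_matI) auto
  then show ?thesis
    unfolding dt_def by (simp add: det_transpose[of _ n])
qed

lemma dt_uminus: "dt n (\<lambda>i j. - f i j) = (-1) ^ n * dt n f"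
proof -
  have "mat n n (\<lambda>(i,j). - f i j) = (-1) \<cdot>\<^sub>m mat n n (\<lambda>(i,j). f i j)"
    by (rule eq_matI) auto
  then show ?thesis
    unfolding dt_def by simp
qed

lemma dt_mult: "dt n (\<lambda>i j. \<Sum>k<n. f i k * g k j) = dt n f * dt n g"
proof -
  have "mat n n (\<lambda>(i,j). \<Sum>k<n. f i k * g k j) = mat n n (\<lambda>(i,j). f i j) * mat n n (\<lambda>(i,j). g i j)"
    by (rule eq_matI) (auto simp: scalar_prod_def atLeast0LessThan)
  then show ?thesis
    unfolding dt_def by (simp add: det_mult[of _ n])
qed

lemma dt_scale_cols:
  "dt n (\<lambda>i j. c j * f i j) = (\<Prod>j<n. c j) * dt n f"
proof -
  have "dt n (\<lambda>i j. c j * f i j) = dt n (\<lambda>i j. \<Sum>k<n. f i k * (if k = j then c j else 0))"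
    by (rule dt_cong) (simp add: if_distrib mult.commute cong: if_cong)
  also have "\<dots> = dt n f * dt n (\<lambda>k j. if k = j then c j else 0)"
    by (rule dt_mult)
  also have "dt n (\<lambda>k j. if k = j then c j else 0) = (\<Prod>j<n. c j)"
    unfolding dt_def
    by (subst det_upper_triangular[of _ n])
       (auto simp: upper_triangular_def diag_mat_def prod.list_conv_set_nth atLeast0LessThan
          intro!: prod.cong)
  finally show ?thesis by (simp add: mult.commute)
qed

lemma dt_zero_row:
  assumes "k < n" "\<And>j. j < n \<Longrightarrow> f k j = 0"
  shows "dt n f = 0"
  unfolding dt_def
  by (subst laplace_expansion_row[of _ n k]) (use assms in auto)

lemma dt_zero_col:
  assumes "k < n" "\<And>i. i < n \<Longrightarrow> f i k = 0"
  shows "dt n f = 0"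
  using dt_zero_row[of k n "\<lambda>i j. f j i"] assms by (simp only: dt_transpose[of n f])

lemma cofactor_mat:
  assumes "i \<le> n" "j \<le> n"
  shows "cofactor (mat (Suc n) (Suc n) (\<lambda>(i,j). f i j)) i j = (-1) ^ (i + j) *
    dt n (\<lambda>i' j'. f (if i' < i then i' else Suc i') (if j' < j then j' else Suc j'))"
proof -
  have "mat_delete (mat (Suc n) (Suc n) (\<lambda>(i,j). f i j)) i j =
    mat n n (\<lambda>(i',j'). f (if i' < i then i' else Suc i') (if j' < j then j' else Suc j'))"
    unfolding mat_delete_def by (rule eq_matI) auto
  then show ?thesis by (simp add: cofactor_def dt_def)
qed

lemma dt_unit_col:
  assumes "k \<le> n" "\<And>i. i \<le> n \<Longrightarrow> i \<noteq> k \<Longrightarrow> f i k = 0"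
  shows "dt (Suc n) f = f k k * dt n (\<lambda>i j. f (if i < k then i else Suc i) (if j < k then j else Suc j))"
proof -
  let ?A = "mat (Suc n) (Suc n) (\<lambda>(i,j). f i j)"
  have "det ?A = (\<Sum>i<Suc n. ?A $$ (i,k) * cofactor ?A i k)"
    by (rule laplace_expansion_column) (use assms in auto)
  also have "\<dots> = (\<Sum>i\<in>{k}. ?A $$ (i,k) * cofactor ?A i k)"
    by (rule sum.mono_neutral_right) (use assms in auto)
  also have "\<dots> = f k k * dt n (\<lambda>i j. f (if i < k then i else Suc i) (if j < k then j else Suc j))"
    using assms(1) by (simp add: cofactor_mat)
  finally show ?thesis by (simp add: dt_def)
qed

lemma dt_last_col:
  assumes "\<And>i. i < n \<Longrightarrow> f i n = 0"
  shows "dt (Suc n) f = f n n * dt n f"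
proof -
  have "dt (Suc n) f = f n n * dt n (\<lambda>i j. f (if i < n then i else Suc i) (if j < n then j else Suc j))"
    by (rule dt_unit_col) (use assms in auto)
  also have "dt n (\<lambda>i j. f (if i < n then i else Suc i) (if j < n then j else Suc j)) = dt n f"
    by (rule dt_cong) auto
  finally show ?thesis .
qed

lemma dt_first_col:
  assumes "\<And>i. 0 < i \<Longrightarrow> i \<le> n \<Longrightarrow> f i 0 = 0"
  shows "dt (Suc n) f = f 0 0 * dt n (\<lambda>i j. f (Suc i) (Suc j))"
  using dt_unit_col[of 0 n f] assms by simp

text \<open>Expanding along column 1 deletes row and column 1, until only the 2 by 2 determinant of
  the corner entries is left.\<close>

lemma dt_middle_unit:
  assumes "\<And>i j. 0 < j \<Longrightarrow> j \<le> n \<Longrightarrow> i \<le> Suc n \<Longrightarrow> f i j = (if i = j then 1 else 0)"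
  shows "dt (Suc (Suc n)) f = f 0 0 * f (Suc n) (Suc n) - f 0 (Suc n) * f (Suc n) 0"
  using assms
proof (induction n arbitrary: f)
  case 0
  show ?case
    unfolding dt_def
    by (subst laplace_expansion_column[of _ "Suc (Suc 0)" 0])
       (auto simp: cofactor_def det_single mat_delete_def algebra_simps)
next
  case (Suc n)
  define g where "g = (\<lambda>i j. f (if i < 1 then i else Suc i) (if j < 1 then j else Suc j))"
  have "dt (Suc (Suc (Suc n))) f = f 1 1 * dt (Suc (Suc n)) g"
    unfolding g_def by (rule dt_unit_col) (use Suc.prems in auto)
  also have "f 1 1 = 1" using Suc.prems[of 1 1] by simp
  also have "dt (Suc (Suc n)) g = g 0 0 * g (Suc n) (Suc n) - g 0 (Suc n) * g (Suc n) 0"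
    by (rule Suc.IH) (auto simp: g_def Suc.prems)
  finally show ?case by (simp add: g_def)
qed

text \<open>Multiply the matrix on the right by the identity matrix with its first and last columns
  replaced by those of the adjugate. The product keeps the middle columns and has \<open>d\<close>
  times a unit vector in the outer ones, so its determinant is \<open>d\<close> squared times the
  central minor; the second factor contributes a 2 by 2 determinant of corner cofactors. One
  \<open>d\<close> is then cancelled.\<close>

lemma desnanot_jacobi_nonzero:
  fixes f :: "nat \<Rightarrow> nat \<Rightarrow> 'a :: idom"
  assumes nz: "dt (Suc (Suc n)) f \<noteq> 0"
  shows "dt (Suc (Suc n)) f * dt n (\<lambda>i j. f (Suc i) (Suc j)) =
    dt (Suc n) f * dt (Suc n) (\<lambda>i j. f (Suc i) (Suc j))
    - dt (Suc n) (\<lambda>i j. f (Suc i) j) * dt (Suc n) (\<lambda>i j. f i (Suc j))"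
proof -
  define N where "N = Suc (Suc n)"
  define A where "A = mat N N (\<lambda>(i,j). f i j)"
  define d where "d = dt N f"
  define b where "b = (\<lambda>i j. if 0 < j \<and> j \<le> n then (if i = j then 1 else 0) else cofactor A j i)"
  have A: "A \<in> carrier_mat N N" by (simp add: A_def)
  have Aadj: "(\<Sum>k<N. f i k * cofactor A j k) = (if i = j then d else 0)" if "i < N" "j < N" for i j
  proof -
    have "(A * adj_mat A) $$ (i,j) = (det A \<cdot>\<^sub>m 1\<^sub>m N) $$ (i,j)"
      using adj_mat(2)[OF A] by simp
    then show ?thesis
      using that A by (auto simp: scalar_prod_def adj_mat_def d_def dt_def A_def atLeast0LessThan)
  qed
  define c where "c = (\<lambda>i j. if 0 < j \<and> j \<le> n then f i j else if i = j then d else 0)"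
  have "dt N c = dt N (\<lambda>i j. \<Sum>k<N. f i k * b k j)"
  proof (rule dt_cong)
    fix i j assume ij: "i < N" "j < N"
    show "c i j = (\<Sum>k<N. f i k * b k j)"
    proof (cases "0 < j \<and> j \<le> n")
      case True
      then have "(\<Sum>k<N. f i k * b k j) = (\<Sum>k<N. if k = j then f i k else 0)"
        by (intro sum.cong) (auto simp: b_def)
      then show ?thesis using True ij by (simp add: c_def)
    next
      case False
      then show ?thesis using Aadj[OF ij] unfolding c_def b_def by (simp only: if_False if_not_P)
    qed
  qed
  also have "\<dots> = d * dt N b" by (simp only: dt_mult d_def)
  also have "dt N b = b 0 0 * b (Suc n) (Suc n) - b 0 (Suc n) * b (Suc n) 0"
    unfolding N_def by (rule dt_middle_unit) (simp add: b_def)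
  also have "b 0 0 = dt (Suc n) (\<lambda>i j. f (Suc i) (Suc j))"
    by (simp add: b_def A_def N_def cofactor_mat)
  also have "b (Suc n) (Suc n) = dt (Suc n) f"
    by (simp add: b_def A_def N_def cofactor_mat flip: mult_2 cong: dt_cong)
  also have "b 0 (Suc n) = (-1) ^ Suc n * dt (Suc n) (\<lambda>i j. f i (Suc j))"
    by (simp add: b_def A_def N_def cofactor_mat cong: dt_cong)
  also have "b (Suc n) 0 = (-1) ^ Suc n * dt (Suc n) (\<lambda>i j. f (Suc i) j)"
    by (simp add: b_def A_def N_def cofactor_mat cong: dt_cong)
  finally have 1: "dt N c = d * (dt (Suc n) (\<lambda>i j. f (Suc i) (Suc j)) * dt (Suc n) f -
     ((-1) ^ Suc n * dt (Suc n) (\<lambda>i j. f i (Suc j))) * ((-1) ^ Suc n * dt (Suc n) (\<lambda>i j. f (Suc i) j)))" .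
  have "dt N c = c (Suc n) (Suc n) * dt (Suc n) c"
    unfolding N_def by (rule dt_last_col) (simp add: c_def)
  also have "dt (Suc n) c = c 0 0 * dt n (\<lambda>i j. c (Suc i) (Suc j))"
    by (rule dt_first_col) (simp add: c_def)
  also have "dt n (\<lambda>i j. c (Suc i) (Suc j)) = dt n (\<lambda>i j. f (Suc i) (Suc j))"
    by (rule dt_cong) (simp add: c_def)
  finally have 2: "dt N c = d * (d * dt n (\<lambda>i j. f (Suc i) (Suc j)))"
    by (simp add: c_def)
  have sgn: "((-1) ^ Suc n * u) * ((-1) ^ Suc n * v) = u * v" for u v :: 'a
  proof -
    have "((-1) ^ Suc n * u) * ((-1) ^ Suc n * v) = ((-1) ^ Suc n * (-1) ^ Suc n) * (u * v)"
      by (simp only: ac_simps)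
    also have "(-1) ^ Suc n * (-1) ^ Suc n = (1 :: 'a)"
      by (simp only: power_add[symmetric]) simp
    finally show ?thesis by simp
  qed
  have "d * (d * dt n (\<lambda>i j. f (Suc i) (Suc j))) = d * (dt (Suc n) (\<lambda>i j. f (Suc i) (Suc j)) * dt (Suc n) f -
     dt (Suc n) (\<lambda>i j. f i (Suc j)) * dt (Suc n) (\<lambda>i j. f (Suc i) j))"
    using 1 2 by (simp only: sgn)
  then have "d * dt n (\<lambda>i j. f (Suc i) (Suc j)) = dt (Suc n) (\<lambda>i j. f (Suc i) (Suc j)) * dt (Suc n) f -
     dt (Suc n) (\<lambda>i j. f i (Suc j)) * dt (Suc n) (\<lambda>i j. f (Suc i) j)"
    using nz by (simp add: d_def N_def)
  then show ?thesis by (simp add: d_def N_def mult.commute)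
qed

lemma poly_dt: "poly (dt n f) t = dt n (\<lambda>i j. poly (f i j) t)"
proof -
  have hom: "comm_ring_hom (\<lambda>p. poly p t)" by unfold_locales auto
  have "map_mat (\<lambda>p. poly p t) (mat n n (\<lambda>(i,j). f i j)) = mat n n (\<lambda>(i,j). poly (f i j) t)"
    by (rule eq_matI) auto
  then show ?thesis unfolding dt_def using comm_ring_hom.hom_det[OF hom, of "mat n n (\<lambda>(i,j). f i j)"]
    by simp
qed

text \<open>Over an integral domain the determinant may vanish, so the identity is first proved for the
  perturbation \<open>f + t I\<close>, whose determinant is a monic polynomial in \<open>t\<close>.\<close>
theorem desnanot_jacobi:
  fixes f :: "nat \<Rightarrow> nat \<Rightarrow> 'a :: idom"
  shows "dt (Suc (Suc n)) f * dt n (\<lambda>i j. f (Suc i) (Suc j)) =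
    dt (Suc n) f * dt (Suc n) (\<lambda>i j. f (Suc i) (Suc j))
    - dt (Suc n) (\<lambda>i j. f (Suc i) j) * dt (Suc n) (\<lambda>i j. f i (Suc j))"
proof -
  define g where "g = (\<lambda>i j. [:f i j, if i = j then 1 else 0:])"
  define A where "A = mat (Suc (Suc n)) (Suc (Suc n)) (\<lambda>(i,j). - f i j)"
  have "char_poly_matrix A = mat (Suc (Suc n)) (Suc (Suc n)) (\<lambda>(i,j). g i j)"
    unfolding char_poly_matrix_def by (rule eq_matI) (auto simp: g_def A_def)
  then have "dt (Suc (Suc n)) g = char_poly A"
    by (simp add: dt_def char_poly_def)
  moreover have "coeff (char_poly A) (Suc (Suc n)) = 1"
    by (rule conjunct2[OF degree_monic_char_poly]) (simp add: A_def)
  ultimately have "dt (Suc (Suc n)) g \<noteq> 0" by auto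
  from arg_cong[OF desnanot_jacobi_nonzero[OF this], of "\<lambda>p. poly p 0"]
  show ?thesis by (simp add: poly_dt g_def)
qed

subsection \<open>A product formula for determinants of factorials\<close>

text \<open>The reciprocal factorial extended by 0, so that \<open>rfact_rec\<close> holds for all
  integers. By contrast \<open>ifact\<close> is 1 at negative arguments and has its recurrence only
  at nonnegative ones.\<close>

definition rfact :: "int \<Rightarrow> rat" where
  "rfact k = (if k < 0 then 0 else 1 / fact (nat k))"

definition ifact :: "int \<Rightarrow> rat" where
  "ifact k = fact (nat k)"

definition poch :: "int \<Rightarrow> nat \<Rightarrow> rat" where
  "poch a n = pochhammer (of_int a) n"

lemma rfact_neg [simp]: "k < 0 \<Longrightarrow> rfact k = 0"
  by (simp add: rfact_def)

lemma rfact_pos: "k \<ge> 0 \<Longrightarrow> rfact k > 0"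
  by (simp add: rfact_def)

lemma rfact_rec: "rfact k = of_int (k + 1) * rfact (k + 1)"
proof -
  consider "k < -1" | "k = -1" | "k \<ge> 0" by linarith
  then show ?thesis
  proof cases
    case 3
    then have "nat (k + 1) = Suc (nat k)" by simp
    moreover have "1 + of_int k > (0 :: rat)" using 3 by (simp add: add_pos_nonneg)
    ultimately show ?thesis using 3 by (simp add: rfact_def fact_Suc add.commute[of _ 1])
  qed (auto simp: rfact_def)
qed

lemma ifact_pos: "ifact k > 0"
  by (simp add: ifact_def)

lemma ifact_rec: "k \<ge> 0 \<Longrightarrow> ifact (k + 1) = of_int (k + 1) * ifact k"
proof -
  assume "k \<ge> 0"
  then have "nat (k + 1) = Suc (nat k)" by simp
  then show ?thesis using \<open>k \<ge> 0\<close> by (simp add: ifact_def fact_Suc)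
qed

lemma poch_0 [simp]: "poch a 0 = 1"
  by (simp add: poch_def)

lemma poch_Suc_left: "poch a (Suc n) = of_int a * poch (a + 1) n"
  by (simp add: poch_def pochhammer_rec)

lemma poch_Suc: "poch a (Suc n) = poch a n * of_int (a + int n)"
  by (simp add: poch_def pochhammer_Suc)

lemma poch_pos: "a > 0 \<Longrightarrow> poch a n > 0"
  by (simp add: poch_def pochhammer_pos)

lemma poch_nonneg_start: "a > 0 \<or> n = 0 \<Longrightarrow> poch a n > 0"
  using poch_pos by auto

definition K :: "int \<Rightarrow> int \<Rightarrow> nat \<Rightarrow> rat" where
  "K x y n = dt n (\<lambda>i j. ifact (x + y + int i + int j - 1) * rfact (x + 2 * int i - int j) * rfact (y + 2 * int j - int i))"

definition kfac :: "int \<Rightarrow> int \<Rightarrow> nat \<Rightarrow> rat" where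
  "kfac x y i = fact i * ifact (x + y + int i - 1) * poch (2 * x + y + 2 * int i) i * poch (x + 2 * y + 2 * int i) i
     * rfact (x + 2 * int i) * rfact (y + 2 * int i)"

definition Kprod :: "int \<Rightarrow> int \<Rightarrow> nat \<Rightarrow> rat" where
  "Kprod x y n = (\<Prod>i<n. kfac x y i)"

text \<open>Deleting the first row replaces (x,y) by (x+2,y-1), deleting the first column replaces
  it by (x-1,y+2), and deleting both by (x+1,y+1): the family is closed under the minors of the
  Desnanot--Jacobi identity.\<close>

lemma K_desnanot:
  "K x y (Suc (Suc n)) * K (x + 1) (y + 1) n =
     K x y (Suc n) * K (x + 1) (y + 1) (Suc n) - K (x + 2) (y - 1) (Suc n) * K (x - 1) (y + 2) (Suc n)"
proof -
  define f where "f = (\<lambda>i j. ifact (x + y + int i + int j - 1) * rfact (x + 2 * int i - int j) * rfact (y + 2 * int j - int i))"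
  have "dt (Suc (Suc n)) f * dt n (\<lambda>i j. f (Suc i) (Suc j)) =
    dt (Suc n) f * dt (Suc n) (\<lambda>i j. f (Suc i) (Suc j))
    - dt (Suc n) (\<lambda>i j. f (Suc i) j) * dt (Suc n) (\<lambda>i j. f i (Suc j))"
    by (rule desnanot_jacobi)
  moreover have "dt k (\<lambda>i j. f (Suc i) (Suc j)) = K (x + 1) (y + 1) k" for k
    unfolding K_def f_def by (intro dt_cong arg_cong2[of _ _ _ _ "(*)"] arg_cong[of _ _ rfact] arg_cong[of _ _ ifact]) auto
  moreover have "dt k (\<lambda>i j. f (Suc i) j) = K (x + 2) (y - 1) k" for k
    unfolding K_def f_def by (intro dt_cong arg_cong2[of _ _ _ _ "(*)"] arg_cong[of _ _ rfact] arg_cong[of _ _ ifact]) auto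
  moreover have "dt k (\<lambda>i j. f i (Suc j)) = K (x - 1) (y + 2) k" for k
    unfolding K_def f_def by (intro dt_cong arg_cong2[of _ _ _ _ "(*)"] arg_cong[of _ _ rfact] arg_cong[of _ _ ifact]) auto
  moreover have "dt k f = K x y k" for k
    unfolding K_def f_def ..
  ultimately show ?thesis by metis
qed

text \<open>The second product on the right-hand side of \<open>K_desnanot\<close>; the factor \<open>(x + y) x y\<close> is cancelled by \<open>kfac_diff\<close>.\<close>
lemma Kprod_shift:
  assumes "x + y \<ge> 1"
  defines "g \<equiv> \<lambda>n. fact n * ifact (x + y + int n) * poch (2 * x + y + 2 * int n + 3) n * poch (x + 2 * y + 2 * int n + 3) n
     * rfact (x + 2 * int n + 2) * rfact (y + 2 * int n + 2)"
  shows "Kprod (x + 2) (y - 1) (Suc n) * Kprod (x - 1) (y + 2) (Suc n) =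
    of_int ((x + y) * x * y) * g n * Kprod x y (Suc n) * Kprod (x + 1) (y + 1) n"
proof (induction n)
  case 0
  have "ifact (x + y) = of_int (x + y) * ifact (x + y - 1)"
    using ifact_rec[of "x + y - 1"] assms(1) by simp
  moreover have "rfact (x - 1) = of_int x * rfact x" "rfact (y - 1) = of_int y * rfact y"
    using rfact_rec[of "x - 1"] rfact_rec[of "y - 1"] by simp_all
  moreover have "x + 2 + (y - 1) - 1 = x + y" "x - 1 + (y + 2) - 1 = x + y" by simp_all
  ultimately show ?case by (simp add: Kprod_def kfac_def g_def del: of_int_add)
next
  case (Suc n)
  have k1: "kfac (x + 2) (y - 1) (Suc n) = fact (Suc n) * ifact (x + y + int n + 1) * poch (2 * x + y + 2 * int n + 5) (Suc n)
     * poch (x + 2 * y + 2 * int n + 2) (Suc n) * rfact (x + 2 * int n + 4) * rfact (y + 2 * int n + 1)"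
    unfolding kfac_def by (intro arg_cong2[of _ _ _ _ "(*)"] arg_cong[of _ _ rfact] arg_cong[of _ _ ifact] arg_cong2[of _ _ _ _ poch]) auto
  have k2: "kfac (x - 1) (y + 2) (Suc n) = fact (Suc n) * ifact (x + y + int n + 1) * poch (2 * x + y + 2 * int n + 2) (Suc n)
     * poch (x + 2 * y + 2 * int n + 5) (Suc n) * rfact (x + 2 * int n + 1) * rfact (y + 2 * int n + 4)"
    unfolding kfac_def by (intro arg_cong2[of _ _ _ _ "(*)"] arg_cong[of _ _ rfact] arg_cong[of _ _ ifact] arg_cong2[of _ _ _ _ poch]) auto
  have k3: "kfac x y (Suc n) = fact (Suc n) * ifact (x + y + int n) * poch (2 * x + y + 2 * int n + 2) (Suc n)
     * poch (x + 2 * y + 2 * int n + 2) (Suc n) * rfact (x + 2 * int n + 2) * rfact (y + 2 * int n + 2)"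
    unfolding kfac_def by (intro arg_cong2[of _ _ _ _ "(*)"] arg_cong[of _ _ rfact] arg_cong[of _ _ ifact] arg_cong2[of _ _ _ _ poch]) auto
  have k4: "kfac (x + 1) (y + 1) n = fact n * ifact (x + y + int n + 1) * poch (2 * x + y + 2 * int n + 3) n
     * poch (x + 2 * y + 2 * int n + 3) n * rfact (x + 2 * int n + 1) * rfact (y + 2 * int n + 1)"
    unfolding kfac_def by (intro arg_cong2[of _ _ _ _ "(*)"] arg_cong[of _ _ rfact] arg_cong[of _ _ ifact] arg_cong2[of _ _ _ _ poch]) auto
  have g1: "g (Suc n) = fact (Suc n) * ifact (x + y + int n + 1) * poch (2 * x + y + 2 * int n + 5) (Suc n)
     * poch (x + 2 * y + 2 * int n + 5) (Suc n) * rfact (x + 2 * int n + 4) * rfact (y + 2 * int n + 4)"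
    unfolding g_def by (intro arg_cong2[of _ _ _ _ "(*)"] arg_cong[of _ _ rfact] arg_cong[of _ _ ifact] arg_cong2[of _ _ _ _ poch]) auto
  have *: "g n * (kfac (x + 2) (y - 1) (Suc n) * kfac (x - 1) (y + 2) (Suc n)) =
    g (Suc n) * (kfac x y (Suc n) * kfac (x + 1) (y + 1) n)"
    unfolding k1 k2 k3 k4 g1 unfolding g_def by (simp only: ac_simps)
  have Ks: "Kprod a b (Suc k) = Kprod a b k * kfac a b k" for a b k
    by (simp add: Kprod_def)
  have "Kprod (x + 2) (y - 1) (Suc (Suc n)) * Kprod (x - 1) (y + 2) (Suc (Suc n)) =
    (Kprod (x + 2) (y - 1) (Suc n) * Kprod (x - 1) (y + 2) (Suc n)) *
    (kfac (x + 2) (y - 1) (Suc n) * kfac (x - 1) (y + 2) (Suc n))"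
    by (simp only: Ks[of _ _ "Suc n"] ac_simps)
  also have "\<dots> = of_int ((x + y) * x * y) * Kprod x y (Suc n) * Kprod (x + 1) (y + 1) n *
     (g n * (kfac (x + 2) (y - 1) (Suc n) * kfac (x - 1) (y + 2) (Suc n)))"
    unfolding Suc.IH by (simp only: ac_simps)
  also have "\<dots> = of_int ((x + y) * x * y) * g (Suc n) * Kprod x y (Suc (Suc n)) * Kprod (x + 1) (y + 1) (Suc n)"
    unfolding * Ks[of x y "Suc n"] Ks[of "x + 1" "y + 1" n] by (simp only: ac_simps)
  finally show ?case .
qed

text \<open>Up to three linear factors each, the two terms are equal; what is left is the cubic
  identity \<open>key\<close>. This is the Desnanot--Jacobi identity for \<open>Kprod\<close> after
  \<open>Kprod_shift\<close> has exposed the common products.\<close>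

lemma kfac_diff:
  assumes "x + y \<ge> 1"
  shows "kfac (x + 1) (y + 1) n - kfac x y (Suc n) = of_int ((x + y) * x * y) *
    (fact n * ifact (x + y + int n) * poch (2 * x + y + 2 * int n + 3) n * poch (x + 2 * y + 2 * int n + 3) n
     * rfact (x + 2 * int n + 2) * rfact (y + 2 * int n + 2))"
proof -
  have k3: "kfac x y (Suc n) = fact (Suc n) * ifact (x + y + int n) * poch (2 * x + y + 2 * int n + 2) (Suc n)
     * poch (x + 2 * y + 2 * int n + 2) (Suc n) * rfact (x + 2 * int n + 2) * rfact (y + 2 * int n + 2)"
    unfolding kfac_def by (intro arg_cong2[of _ _ _ _ "(*)"] arg_cong[of _ _ rfact] arg_cong[of _ _ ifact] arg_cong2[of _ _ _ _ poch]) auto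
  have k4: "kfac (x + 1) (y + 1) n = fact n * ifact (x + y + int n + 1) * poch (2 * x + y + 2 * int n + 3) n
     * poch (x + 2 * y + 2 * int n + 3) n * rfact (x + 2 * int n + 1) * rfact (y + 2 * int n + 1)"
    unfolding kfac_def by (intro arg_cong2[of _ _ _ _ "(*)"] arg_cong[of _ _ rfact] arg_cong[of _ _ ifact] arg_cong2[of _ _ _ _ poch]) auto
  have p: "poch (2 * x + y + 2 * int n + 2) (Suc n) = of_int (2 * x + y + 2 * int n + 2) * poch (2 * x + y + 2 * int n + 3) n"
    "poch (x + 2 * y + 2 * int n + 2) (Suc n) = of_int (x + 2 * y + 2 * int n + 2) * poch (x + 2 * y + 2 * int n + 3) n"
    using poch_Suc_left[of "2 * x + y + 2 * int n + 2" n] poch_Suc_left[of "x + 2 * y + 2 * int n + 2" n] by (simp_all add: add.assoc)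
  have f: "rfact (x + 2 * int n + 1) = of_int (x + 2 * int n + 2) * rfact (x + 2 * int n + 2)"
     "rfact (y + 2 * int n + 1) = of_int (y + 2 * int n + 2) * rfact (y + 2 * int n + 2)"
    using rfact_rec[of "x + 2 * int n + 1"] rfact_rec[of "y + 2 * int n + 1"] by (simp_all add: add.assoc)
  have s: "ifact (x + y + int n + 1) = of_int (x + y + int n + 1) * ifact (x + y + int n)"
    by (rule ifact_rec) (use assms in auto)
  have key: "(x + y + int n + 1) * (x + 2 * int n + 2) * (y + 2 * int n + 2)
    - int (Suc n) * (2 * x + y + 2 * int n + 2) * (x + 2 * y + 2 * int n + 2) = (x + y) * x * y"
    by (simp add: algebra_simps)
  have key': "of_int (x + y + int n + 1) * of_int (x + 2 * int n + 2) * of_int (y + 2 * int n + 2)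
    - of_nat (Suc n) * of_int (2 * x + y + 2 * int n + 2) * of_int (x + 2 * y + 2 * int n + 2) = (of_int ((x + y) * x * y) :: rat)"
    unfolding key[symmetric] by (simp only: of_int_diff of_int_mult of_int_of_nat_eq)
  define c where "c = fact n * ifact (x + y + int n) * poch (2 * x + y + 2 * int n + 3) n * poch (x + 2 * y + 2 * int n + 3) n
     * rfact (x + 2 * int n + 2) * rfact (y + 2 * int n + 2)"
  have 1: "kfac (x + 1) (y + 1) n = of_int (x + y + int n + 1) * of_int (x + 2 * int n + 2) * of_int (y + 2 * int n + 2) * c"
    unfolding k4 f s c_def by (simp only: ac_simps)
  have 2: "kfac x y (Suc n) = of_nat (Suc n) * of_int (2 * x + y + 2 * int n + 2) * of_int (x + 2 * y + 2 * int n + 2) * c"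
    unfolding k3 p c_def fact_Suc by (simp only: ac_simps)
  show ?thesis
    unfolding c_def[symmetric] key'[symmetric] 1 2 by (simp only: left_diff_distrib)
qed

lemma kfac_pos: "x + y \<ge> 1 \<Longrightarrow> x \<ge> 0 \<Longrightarrow> y \<ge> 0 \<Longrightarrow> kfac x y i > 0"
  unfolding kfac_def by (intro mult_pos_pos ifact_pos rfact_pos poch_pos) auto

text \<open>For negative x the first row vanishes, for negative y the first column. Such arguments
  occur because the recurrence passes through x-1 and y-1.\<close>

lemma K_neg:
  assumes "x < 0 \<or> y < 0" "n > 0"
  shows "K x y n = 0"
  using assms(1)
proof
  assume "x < 0"
  then show ?thesis unfolding K_def by (intro dt_zero_row[of 0]) (use assms in auto)
next
  assume "y < 0"
  then show ?thesis unfolding K_def by (intro dt_zero_col[of 0]) (use assms in auto)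
qed

lemma Kprod_neg:
  assumes "x < 0 \<or> y < 0" "n > 0"
  shows "Kprod x y n = 0"
  unfolding Kprod_def by (intro prod_zero bexI[of _ 0]) (use assms in \<open>auto simp: kfac_def\<close>)

lemma Kprod_pos: "x + y \<ge> 1 \<Longrightarrow> x \<ge> 0 \<Longrightarrow> y \<ge> 0 \<Longrightarrow> Kprod x y n > 0"
  unfolding Kprod_def by (intro prod_pos) (auto intro: kfac_pos)

text \<open>Both sides satisfy the same recurrence, and all shifts in it preserve
  \<open>x + y \<ge> 1\<close>. For nonnegative x and y the factor
  \<open>Kprod (x + 1) (y + 1) m\<close> is positive and can be cancelled; otherwise both sides are
  zero as soon as n is positive.\<close>

theorem K_eq_Kprod: "x + y \<ge> 1 \<Longrightarrow> K x y n = Kprod x y n"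
proof (induction n arbitrary: x y rule: less_induct)
  case (less n)
  consider "n = 0" | "n = 1" | m where "n = Suc (Suc m)"
    by (metis One_nat_def not0_implies_Suc)
  then show ?case
  proof cases
    case 1 then show ?thesis by (simp add: K_def Kprod_def)
  next
    case 2 then show ?thesis by (simp add: K_def Kprod_def kfac_def)
  next
    case 3
    show ?thesis
    proof (cases "x < 0 \<or> y < 0")
      case True
      then show ?thesis using 3 by (simp add: K_neg Kprod_neg)
    next
      case False
      have pos: "Kprod (x + 1) (y + 1) m > 0"
        by (rule Kprod_pos) (use False in auto)
      have "K x y (Suc (Suc m)) * Kprod (x + 1) (y + 1) m =
        Kprod x y (Suc m) * Kprod (x + 1) (y + 1) (Suc m) - Kprod (x + 2) (y - 1) (Suc m) * Kprod (x - 1) (y + 2) (Suc m)"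
        using K_desnanot[of x y m] less.IH[of _ x y] less.IH[of _ "x + 1" "y + 1"] less.IH[of _ "x + 2" "y - 1"]
          less.IH[of _ "x - 1" "y + 2"] less.prems 3 by simp
      also have "\<dots> = Kprod x y (Suc m) * Kprod (x + 1) (y + 1) m * kfac x y (Suc m)"
        unfolding Kprod_shift[OF less.prems]
        using kfac_diff[OF less.prems, of m] by (simp add: Kprod_def algebra_simps)
      also have "\<dots> = Kprod x y (Suc (Suc m)) * Kprod (x + 1) (y + 1) m"
        by (simp add: Kprod_def)
      finally show ?thesis using pos 3 by simp
    qed
  qed
qed

subsection \<open>Column reduction and the two-term recurrence\<close>

definition bin :: "int \<Rightarrow> int \<Rightarrow> rat" where
  "bin N k = ifact N * rfact k * rfact (N - k)"

lemma of_int_ibinom: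
  assumes "N \<ge> 0"
  shows "of_int (ibinom N k) = bin N k"
proof (cases "0 \<le> k \<and> k \<le> N")
  case True
  then have le: "nat k \<le> nat N" and eq: "nat (N - k) = nat N - nat k" by auto
  then show ?thesis using True
    by (simp add: ibinom_def bin_def rfact_def ifact_def binomial_fact)
next
  case False
  then show ?thesis by (auto simp: ibinom_def bin_def)
qed

lemma bin_pascal:
  assumes "N \<ge> 0"
  shows "bin (N + 1) k = bin N k + bin N (k - 1)"
proof -
  have 1: "rfact (k - 1) = of_int k * rfact k" and 2: "rfact (N - k) = of_int (N + 1 - k) * rfact (N + 1 - k)"
    using rfact_rec[of "k - 1"] rfact_rec[of "N - k"] by (simp_all add: diff_add_eq)
  have 3: "N - (k - 1) = N + 1 - k" and 4: "N + 1 = (N + 1 - k) + k" by simp_all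
  have "bin (N + 1) k = of_int ((N + 1 - k) + k) * ifact N * rfact k * rfact (N + 1 - k)"
    unfolding bin_def ifact_rec[OF assms] by simp
  also have "\<dots> = bin N k + bin N (k - 1)"
    unfolding bin_def 1 2 3 of_int_add[of "N + 1 - k" k] by (simp only: distrib_left distrib_right ac_simps)
  finally show ?thesis .
qed

lemma bin_neg [simp]: "k < 0 \<Longrightarrow> bin N k = 0"
  by (simp add: bin_def)

text \<open>Since \<open>bin\<close> vanishes at negative arguments, this is the sum over all r up
  to B. A signed sum is the difference of two such values, whatever the order of its ends.\<close>

definition psum :: "int \<Rightarrow> int \<Rightarrow> rat" where
  "psum N B = (\<Sum>r\<in>{0..B}. bin N r)"

lemma psum_rec: "psum N B = psum N (B - 1) + bin N B"
proof (cases "B \<ge> 0")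
  case True
  then have "{0..B} = insert B {0..B - 1}" by auto
  then show ?thesis by (simp add: psum_def)
qed (simp add: psum_def)

lemma sum_telescope_int:
  fixes g :: "int \<Rightarrow> rat"
  assumes "\<And>r. g r = g (r - 1) + f r" "A \<le> B"
  shows "(\<Sum>r\<in>{A + 1..B}. f r) = g B - g A"
  using assms(2)
proof (induction B rule: int_ge_induct)
  case base
  show ?case by simp
next
  case (step B)
  then have "{A + 1..B + 1} = insert (B + 1) {A + 1..B}" by auto
  then show ?case using step assms(1)[of "B + 1"] by simp
qed

lemma ssum_ibinom:
  assumes "N \<ge> 0"
  shows "of_int (ssum A B (ibinom N)) = psum N B - psum N A"
  using sum_telescope_int[of "psum N" "bin N", OF psum_rec, of A B]
    sum_telescope_int[of "psum N" "bin N", OF psum_rec, of B A]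
  by (auto simp: ssum_def of_int_ibinom[OF assms])

lemma psum_pascal:
  assumes "N \<ge> 0"
  shows "psum (N + 1) B = psum N B + psum N (B - 1)"
proof (cases "B \<ge> 0")
  case True
  then show ?thesis
  proof (induction B rule: int_ge_induct)
    case base
    show ?case using psum_rec[of "N+1" 0] psum_rec[of N 0] bin_pascal[OF assms, of 0] by (simp add: psum_def)
  next
    case (step B)
    then show ?case
      using psum_rec[of "N+1" "B+1"] psum_rec[of N "B+1"] psum_rec[of N B] bin_pascal[OF assms, of "B+1"] by simp
  qed
qed (simp add: psum_def)

text \<open>By Pascal's rule, only four binomial coefficients at the ends of the two ranges survive.
  As \<open>A + B = N\<close>, they are multiples of one product of reciprocal factorials; the
  multipliers add up to a product of two linear factors, one of which turns N! into (N+1)!.\<close>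

lemma ssum_step:
  assumes "N \<ge> 0" "A + B = N"
  shows "(psum (N + 1) (B + 2) - psum (N + 1) (A - 1)) - 2 * (psum N B - psum N A) =
    ifact (N + 1) * of_int (A + 2 * B + 4) * rfact (B + 2) * rfact A"
proof -
  define u v a b where "u = rfact (B + 2)" and "v = rfact A" and "a = (of_int A :: rat)" and "b = (of_int B :: rat)"
  have F1: "rfact (B + 1) = (b + 2) * u" using rfact_rec[of "B + 1"] by (simp add: u_def b_def ac_simps)
  have F2: "rfact B = (b + 1) * (b + 2) * u" using rfact_rec[of B] F1 by (simp add: b_def ac_simps)
  have F3: "rfact (A - 1) = a * v" using rfact_rec[of "A - 1"] by (simp add: v_def a_def)
  have F4: "rfact (A - 2) = a * (a - 1) * v" using rfact_rec[of "A - 2"] F3 by (simp add: a_def ac_simps)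
  have N: "N - (B + 1) = A - 1" "N - (B + 2) = A - 2" "N - A = B" "N - (A - 1) = B + 1" "N - B = A"
    using assms by auto
  have Fa1: "ifact (N + 1) = (a + b + 1) * ifact N"
    using ifact_rec[OF assms(1)] assms(2)[symmetric] by (simp add: a_def b_def)
  have "(psum (N + 1) (B + 2) - psum (N + 1) (A - 1)) - 2 * (psum N B - psum N A) =
    2 * bin N (B + 1) + bin N (B + 2) + 2 * bin N A + bin N (A - 1)"
    using psum_pascal[OF assms(1), of "B + 2"] psum_pascal[OF assms(1), of "A - 1"]
      psum_rec[of N "B + 2"] psum_rec[of N "B + 1"] psum_rec[of N A] psum_rec[of N "A - 1"]
    by (simp add: algebra_simps)
  also have "\<dots> = ifact N * u * v * ((a + b + 1) * (a + 2 * b + 4))"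
    unfolding bin_def N F1 F2 F3 F4 u_def[symmetric] v_def[symmetric] by (simp add: algebra_simps)
  also have "\<dots> = ifact (N + 1) * of_int (A + 2 * B + 4) * rfact (B + 2) * rfact A"
    unfolding Fa1 by (simp add: a_def b_def u_def v_def)
  finally show ?thesis .
qed

definition Dentry :: "int \<Rightarrow> int \<Rightarrow> nat \<Rightarrow> nat \<Rightarrow> rat" where
  "Dentry x y i j = psum (x + y + int i + int j) (y + 2 * int j - int i) - psum (x + y + int i + int j) (x + 2 * int i - int j)"

lemma Dentry_eqI:
  "x + y + int i + int j = N \<Longrightarrow> x + 2 * int i - int j = A \<Longrightarrow> y + 2 * int j - int i = B
    \<Longrightarrow> Dentry x y i j = psum N B - psum N A"
  by (simp add: Dentry_def)

definition Dentry_det :: "int \<Rightarrow> int \<Rightarrow> nat \<Rightarrow> rat" where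
  "Dentry_det x y n = dt n (Dentry x y)"

lemma of_int_D:
  assumes "x + y \<ge> 0"
  shows "of_int (D x y n) = Dentry_det x y n"
proof -
  have "map_mat of_int (Dmat x y n) = mat n n (\<lambda>(i,j). Dentry x y i j)"
    unfolding Dmat_def by (rule eq_matI) (use assms in \<open>auto simp: Dentry_def ssum_ibinom\<close>)
  then show ?thesis
    unfolding D_def Dentry_det_def dt_def by (metis of_int_hom.hom_det)
qed

text \<open>Interchanging x and y transposes the matrix and exchanges the ends of every signed sum,
  which changes the sign of each entry.\<close>

lemma Dentry_det_swap: "Dentry_det y x n = (-1) ^ n * Dentry_det x y n"
proof -
  have "Dentry_det y x n = dt n (\<lambda>i j. - Dentry x y j i)"
    unfolding Dentry_det_def by (rule dt_cong) (simp add: Dentry_def ac_simps)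
  also have "\<dots> = (-1) ^ n * dt n (\<lambda>i j. Dentry x y j i)" by (rule dt_uminus)
  also have "dt n (\<lambda>i j. Dentry x y j i) = Dentry_det x y n" unfolding Dentry_det_def by (rule dt_transpose)
  finally show ?thesis .
qed

text \<open>The row index cancels in the factor \<open>A + 2 * B + 4\<close> of
  \<open>ssum_step\<close>, so this factor can be taken out of the column; what remains is the
  matrix of \<open>K x (y + 2)\<close>.\<close>

lemma Dentry_step:
  assumes "x + y \<ge> 0"
  shows "Dentry x y i (Suc j) - 2 * Dentry x y i j =
    of_int (x + 2 * y + 3 * int j + 4) * (ifact (x + (y + 2) + int i + int j - 1) * rfact (x + 2 * int i - int j) * rfact (y + 2 + 2 * int j - int i))"
proof -
  define N A B where "N = x + y + int i + int j" and "A = x + 2 * int i - int j" and "B = y + 2 * int j - int i"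
  have "Dentry x y i (Suc j) - 2 * Dentry x y i j = (psum (N + 1) (B + 2) - psum (N + 1) (A - 1)) - 2 * (psum N B - psum N A)"
  proof -
    have "Dentry x y i (Suc j) = psum (N + 1) (B + 2) - psum (N + 1) (A - 1)"
      by (rule Dentry_eqI) (auto simp: N_def A_def B_def)
    then show ?thesis by (simp add: Dentry_def N_def A_def B_def)
  qed
  also have "\<dots> = ifact (N + 1) * of_int (A + 2 * B + 4) * rfact (B + 2) * rfact A"
    by (rule ssum_step) (use assms in \<open>auto simp: N_def A_def B_def\<close>)
  also have "\<dots> = of_int (A + 2 * B + 4) * (ifact (N + 1) * rfact A * rfact (B + 2))" by (simp only: ac_simps)
  also have "\<dots> = of_int (x + 2 * y + 3 * int j + 4) * (ifact (x + (y + 2) + int i + int j - 1) * rfact (x + 2 * int i - int j) * rfact (y + 2 + 2 * int j - int i))"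
    unfolding N_def A_def B_def
    by (intro arg_cong2[of _ _ _ _ "(*)"] arg_cong[of _ _ rfact] arg_cong[of _ _ ifact] arg_cong[of _ _ of_int]) auto
  finally show ?thesis .
qed

text \<open>All columns are changed at once, by multiplication with a unit upper triangular matrix.
  As this works for every size, the leading minors are preserved as well.\<close>

lemma dt_col_reduce: "dt n (\<lambda>i j. if j = 0 then f i j else f i j - c * f i (j - 1)) = dt n f"
proof -
  define U where "U = (\<lambda>k j. if k = j then 1 else if Suc k = j then - c else 0)"
  have "dt n (\<lambda>i j. if j = 0 then f i j else f i j - c * f i (j - 1)) = dt n (\<lambda>i j. \<Sum>k<n. f i k * U k j)"
  proof (rule dt_cong)
    fix i j assume ij: "i < n" "j < n"
    have "(\<Sum>k<n. f i k * U k j) = (\<Sum>k<n. if k = j then f i k else 0) + (\<Sum>k<n. if Suc k = j then - c * f i k else 0)"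
      unfolding sum.distrib[symmetric] by (rule sum.cong) (auto simp: U_def)
    also have "(\<Sum>k<n. if Suc k = j then - c * f i k else 0) = (if j = 0 then 0 else - c * f i (j - 1))"
    proof (cases j)
      case (Suc l)
      then have "(\<Sum>k<n. if Suc k = j then - c * f i k else 0) = (\<Sum>k<n. if k = l then - c * f i k else 0)"
        by (intro sum.cong) auto
      then show ?thesis using Suc ij by simp
    qed simp
    finally show "(if j = 0 then f i j else f i j - c * f i (j - 1)) = (\<Sum>k<n. f i k * U k j)"
      using ij by simp
  qed
  also have "\<dots> = dt n f * dt n U" by (rule dt_mult)
  also have "dt n U = 1"
    unfolding dt_def
    by (subst det_upper_triangular[of _ n])
       (auto simp: U_def upper_triangular_def diag_mat_def prod.list_conv_set_nth)
  finally show ?thesis by simp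
qed

text \<open>The minor of the reduced matrix that omits the first column: the column factors times a
  determinant known from \<open>K_eq_Kprod\<close>.\<close>

definition Af :: "int \<Rightarrow> int \<Rightarrow> nat \<Rightarrow> rat" where
  "Af x y n = (\<Prod>j<n. of_int (x + 2 * y + 3 * int j + 4)) * K x (y + 2) n"

text \<open>The identity is applied to the reduced matrix \<open>M\<close>. For minors that start at
  the first column the reduction can be undone, which gives \<open>Dentry_det\<close> again; those
  that omit it are the known products \<open>Af\<close>. Deleting the first row replaces (x,y) by
  (x+2,y-1).\<close>

lemma Dentry_det_desnanot:
  assumes "x + y \<ge> 0"
  shows "Dentry_det x y (Suc (Suc k)) * Af (x + 2) (y - 1) k =
    Dentry_det x y (Suc k) * Af (x + 2) (y - 1) (Suc k) - Dentry_det (x + 2) (y - 1) (Suc k) * Af x y (Suc k)"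
proof -
  define M where "M = (\<lambda>i j. if j = 0 then Dentry x y i j else Dentry x y i j - 2 * Dentry x y i (j - 1))"
  have M_Suc: "M i (Suc j) = of_int (x + 2 * y + 3 * int j + 4) *
     (ifact (x + (y + 2) + int i + int j - 1) * rfact (x + 2 * int i - int j) * rfact (y + 2 + 2 * int j - int i))" for i j
    using Dentry_step[OF assms, of i j] by (simp add: M_def)
  have "dt (Suc (Suc k)) M * dt k (\<lambda>i j. M (Suc i) (Suc j)) =
    dt (Suc k) M * dt (Suc k) (\<lambda>i j. M (Suc i) (Suc j))
    - dt (Suc k) (\<lambda>i j. M (Suc i) j) * dt (Suc k) (\<lambda>i j. M i (Suc j))"
    by (rule desnanot_jacobi)
  moreover have "dt n M = Dentry_det x y n" for n
    unfolding M_def Dentry_det_def by (rule dt_col_reduce)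
  moreover have "dt n (\<lambda>i j. M (Suc i) j) = Dentry_det (x + 2) (y - 1) n" for n
  proof -
    have sh: "Dentry x y (Suc i) j = Dentry (x + 2) (y - 1) i j" for i j
      unfolding Dentry_def[of "x + 2"] by (rule Dentry_eqI) auto
    have "(\<lambda>i j. M (Suc i) j) = (\<lambda>i j. if j = 0 then Dentry (x + 2) (y - 1) i j else Dentry (x + 2) (y - 1) i j - 2 * Dentry (x + 2) (y - 1) i (j - 1))"
      by (simp only: M_def sh)
    then show ?thesis by (simp only: dt_col_reduce Dentry_det_def)
  qed
  moreover have "dt n (\<lambda>i j. M i (Suc j)) = Af x y n" for n
    unfolding M_Suc dt_scale_cols Af_def K_def ..
  moreover have "dt n (\<lambda>i j. M (Suc i) (Suc j)) = Af (x + 2) (y - 1) n" for n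
    unfolding M_Suc dt_scale_cols Af_def K_def
    by (intro dt_cong prod.cong refl arg_cong2[of _ _ _ _ "(*)"] arg_cong[of _ _ rfact] arg_cong[of _ _ ifact] arg_cong[of _ _ of_int]) auto
  ultimately show ?thesis by metis
qed

section \<open>Normalisation by the expected product\<close>

definition afac :: "int \<Rightarrow> int \<Rightarrow> nat \<Rightarrow> rat" where
  "afac x y i = fact i * ifact (x + y + int i + 1) * poch (2 * x + y + 2 * int i + 2) i * poch (x + 2 * y + 2 * int i + 4) (Suc i)
     * rfact (x + 2 * int i) * rfact (y + 2 * int i + 2)"

text \<open>The column factor x+2y+3i+4 is the next factor of the second Pochhammer symbol in
  \<open>kfac x (y + 2) i\<close>; hence the length \<open>Suc i\<close> in
  \<open>afac\<close>.\<close>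

lemma Af_eq:
  assumes "x + y \<ge> -1"
  shows "Af x y n = (\<Prod>i<n. afac x y i)"
proof -
  have "of_int (x + 2 * y + 3 * int i + 4) * kfac x (y + 2) i = afac x y i" for i
  proof -
    have "kfac x (y + 2) i = fact i * ifact (x + y + int i + 1) * poch (2 * x + y + 2 * int i + 2) i * poch (x + 2 * y + 2 * int i + 4) i
     * rfact (x + 2 * int i) * rfact (y + 2 * int i + 2)"
      unfolding kfac_def by (intro arg_cong2[of _ _ _ _ "(*)"] arg_cong[of _ _ rfact] arg_cong[of _ _ ifact] arg_cong2[of _ _ _ _ poch]) auto
    moreover have "poch (x + 2 * y + 2 * int i + 4) (Suc i) = poch (x + 2 * y + 2 * int i + 4) i * of_int (x + 2 * y + 3 * int i + 4)"
      unfolding poch_Suc by (intro arg_cong2[of _ _ _ _ "(*)"] arg_cong[of _ _ of_int]) auto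
    ultimately show ?thesis unfolding afac_def by (simp only: ac_simps)
  qed
  then show ?thesis
    using assms by (simp add: Af_def K_eq_Kprod Kprod_def flip: prod.distrib)
qed

text \<open>For \<open>s = 2x + m\<close> this is the factor of the product formula that depends on the parities of \<open>m\<close> and \<open>n\<close>;
  for odd \<open>n\<close> and even \<open>m\<close> it contains \<open>2x + m + n\<close>, which accounts for the divisibility of the polynomial.\<close>
definition h :: "nat \<Rightarrow> int \<Rightarrow> rat" where
  "h n s = (if even s then \<Prod>i<(n + 1) div 2. of_int (s + 1 + 2 * int i)
            else \<Prod>i<n div 2. of_int (s + 2 + 2 * int i)) / ifact (s div 2)"

lemma h_Suc: "h (Suc n) s = h n s * (if even (s + int n) then of_int (s + int n + 1) else 1)"
proof (cases "even n")
  case True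
  then obtain k where "n = 2 * k" by blast
  then show ?thesis by (auto simp: h_def)
next
  case False
  then obtain k where "n = 2 * k + 1" by (auto elim: oddE)
  then show ?thesis by (auto simp: h_def)
qed

lemma h_pos: "s \<ge> 0 \<Longrightarrow> h n s > 0"
  unfolding h_def by (auto intro!: divide_pos_pos prod_pos ifact_pos)

text \<open>The reciprocal factorials for i = 0 are left out. Thus \<open>W\<close> can be positive
  when x or y is -1, values that the recurrence visits; the factor 1/(x+m)! of the final formula is
  supplied by \<open>R\<close>.\<close>

definition W :: "int \<Rightarrow> int \<Rightarrow> nat \<Rightarrow> rat" where
  "W x y n = (\<Prod>i<n. ifact (x + y + int i) * poch (2 * x + y + 2 * int i + 2) i * poch (x + 2 * y + 2 * int i + 2) i)
     * (\<Prod>i\<in>{1..<n}. rfact (x + 2 * int i) * rfact (y + 2 * int i)) * h n (x + y)"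

text \<open>The quotient of \<open>W x y (k + 2)\<close> and \<open>W x y (k + 1)\<close>, apart from the contribution of \<open>h\<close>.\<close>
definition wfac :: "int \<Rightarrow> int \<Rightarrow> nat \<Rightarrow> rat" where
  "wfac x y k = ifact (x + y + int k + 1) * poch (2 * x + y + 2 * int k + 4) (Suc k) * poch (x + 2 * y + 2 * int k + 4) (Suc k)
     * rfact (x + 2 * int k + 2) * rfact (y + 2 * int k + 2)"

lemma W_Suc: "W x y (Suc (Suc k)) = W x y (Suc k) * wfac x y k *
    (if even (x + y + int (Suc k)) then of_int (x + y + int k + 2) else 1)"
proof -
  have e: "wfac x y k = ifact (x + y + int (Suc k)) * poch (2 * x + y + 2 * int (Suc k) + 2) (Suc k) * poch (x + 2 * y + 2 * int (Suc k) + 2) (Suc k)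
     * (rfact (x + 2 * int (Suc k)) * rfact (y + 2 * int (Suc k)))"
    unfolding wfac_def mult.assoc by (intro arg_cong2[of _ _ _ _ "(*)"] arg_cong[of _ _ rfact] arg_cong[of _ _ ifact] arg_cong2[of _ _ _ _ poch]) auto
  have i: "x + y + int (Suc k) + 1 = x + y + int k + 2" by simp
  have "{1..<Suc (Suc k)} = insert (Suc k) {1..<Suc k}" by auto
  then have p: "(\<Prod>i\<in>{1..<Suc (Suc k)}. rfact (x + 2 * int i) * rfact (y + 2 * int i)) =
     (rfact (x + 2 * int (Suc k)) * rfact (y + 2 * int (Suc k))) * (\<Prod>i\<in>{1..<Suc k}. rfact (x + 2 * int i) * rfact (y + 2 * int i))"
    by (simp only:) (subst prod.insert, auto)
  show ?thesis
    unfolding W_def h_Suc[of "Suc k"] p e prod.lessThan_Suc[of _ "Suc k"] i by (simp only: ac_simps)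
qed

lemma W_pos:
  assumes "x \<ge> -1" "y \<ge> -1" "x + y \<ge> 0"
  shows "W x y n > 0"
proof -
  have "poch (2 * x + y + 2 * int i + 2) i > 0" "poch (x + 2 * y + 2 * int i + 2) i > 0" for i
    by (rule poch_nonneg_start; use assms in \<open>cases i; simp\<close>)+
  then show ?thesis
    unfolding W_def using assms by (intro mult_pos_pos prod_pos h_pos ballI conjI ifact_pos rfact_pos) auto
qed

lemma afac_pos:
  assumes "x \<ge> 1" "y \<ge> -1"
  shows "afac x y i > 0"
  unfolding afac_def using assms by (intro mult_pos_pos ifact_pos rfact_pos poch_pos) auto

text \<open>The complement of the factor in \<open>h_Suc\<close>: the two always multiply to s+n+1,
  the factor that occurs in \<open>afac_wfac\<close>.\<close>

definition eps :: "nat \<Rightarrow> int \<Rightarrow> rat" where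
  "eps n s = (if even (s + int n) then 1 else of_int (s + int n + 1))"

definition kap :: "int \<Rightarrow> rat" where
  "kap s = (if even s then 1 else 2)"

lemma afac_shift: "afac (x + 2) (y - 1) k = fact k * ifact (x + y + int k + 2) * poch (2 * x + y + 2 * int k + 5) k
    * poch (x + 2 * y + 2 * int k + 4) (Suc k) * rfact (x + 2 * int k + 2) * rfact (y + 2 * int k + 1)"
  unfolding afac_def by (intro arg_cong2[of _ _ _ _ "(*)"] arg_cong[of _ _ rfact] arg_cong[of _ _ ifact] arg_cong2[of _ _ _ _ poch]) auto

lemma afac_wfac:
  assumes "x + y \<ge> 0"
  shows "of_int (2 * x + y + 2 * int k + 4) * afac (x + 2) (y - 1) k =
    fact k * of_int (x + y + int k + 2) * of_int (y + 2 * int k + 2) * wfac x y k"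
proof -
  have "poch (2 * x + y + 2 * int k + 4) (Suc k) = of_int (2 * x + y + 2 * int k + 4) * poch (2 * x + y + 2 * int k + 5) k"
    using poch_Suc_left[of "2 * x + y + 2 * int k + 4"] by (simp add: add.assoc)
  moreover have "rfact (y + 2 * int k + 1) = of_int (y + 2 * int k + 2) * rfact (y + 2 * int k + 2)"
    using rfact_rec[of "y + 2 * int k + 1"] by (simp add: add.assoc)
  moreover have "ifact (x + y + int k + 2) = of_int (x + y + int k + 2) * ifact (x + y + int k + 1)"
    using ifact_rec[of "x + y + int k + 1"] assms by (simp add: add.assoc)
  ultimately show ?thesis
    unfolding afac_shift wfac_def by (simp only: ac_simps)
qed

text \<open>Normalises the first term of the recurrence. The first Pochhammer symbol of
  \<open>wfac x y k\<close> starts one factor earlier than that of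
  \<open>afac (x + 2) (y - 1) k\<close>, hence the linear factor on the left.\<close>

lemma W_rec1:
  assumes "x + y \<ge> 0"
  shows "of_int (2 * x + y + 2 * int k + 4) * (W x y (Suc k) * afac (x + 2) (y - 1) k) =
    fact k * (eps (Suc k) (x + y) * of_int (y + 2 * int k + 2)) * W x y (Suc (Suc k))"
proof -
  have e: "eps (Suc k) (x + y) * (if even (x + y + int (Suc k)) then of_int (x + y + int k + 2) else 1)
    = of_int (x + y + int k + 2)"
    by (simp add: eps_def)
  have "of_int (2 * x + y + 2 * int k + 4) * (W x y (Suc k) * afac (x + 2) (y - 1) k) =
    W x y (Suc k) * (of_int (2 * x + y + 2 * int k + 4) * afac (x + 2) (y - 1) k)"
    by (simp only: ac_simps)
  also have "\<dots> = W x y (Suc k) * (fact k * (eps (Suc k) (x + y) *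
     (if even (x + y + int (Suc k)) then of_int (x + y + int k + 2) else 1)) * of_int (y + 2 * int k + 2) * wfac x y k)"
    unfolding afac_wfac[OF assms] e ..
  also have "\<dots> = fact k * (eps (Suc k) (x + y) * of_int (y + 2 * int k + 2)) * W x y (Suc (Suc k))"
    unfolding W_Suc by (simp only: ac_simps)
  finally show ?thesis .
qed

text \<open>For odd s, \<open>s + 1 = 2 * (s div 2 + 1)\<close>: the second factor is absorbed by
  the larger factorial in the denominator of \<open>h\<close>, and the 2 survives as
  \<open>kap s\<close>.\<close>

lemma h_kap:
  assumes "s \<ge> 0"
  shows "h (Suc 0) (s + 1) * of_int (s + 1) = kap s * h (Suc (Suc 0)) s"
proof (cases "even s")
  case True
  then have "(s + 1) div 2 = s div 2" by (auto elim: evenE)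
  then show ?thesis using True by (simp add: h_def kap_def)
next
  case False
  then have "(s + 1) div 2 = s div 2 + 1" by (auto elim: oddE)
  moreover have "of_int (s + 1) = (2 :: rat) * of_int (s div 2 + 1)"
  proof -
    have "s + 1 = 2 * (s div 2 + 1)" using False by (auto elim: oddE)
    then have "of_int (s + 1) = (of_int (2 * (s div 2 + 1)) :: rat)" by simp
    then show ?thesis by (simp only: of_int_mult of_int_numeral)
  qed
  moreover have "ifact (s div 2 + 1) = of_int (s div 2 + 1) * ifact (s div 2)"
    by (rule ifact_rec) (use assms in auto)
  moreover have "of_int (s div 2 + 1) \<noteq> (0 :: rat)" using assms by (simp only: of_int_eq_0_iff)
  ultimately show ?thesis using False
    by (simp add: h_def kap_def field_simps del: of_int_add) 
qed

text \<open>Normalises the second term. Apart from the explicit linear factor and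
  \<open>fact k\<close>, both sides change alike from k to k+1, so \<open>kap (x + y)\<close> and
  (x+1)(x+2) arise at k = 0, from \<open>h_kap\<close> and from comparing x! with (x+2)!.\<close>

lemma W_rec2:
  assumes "x + y \<ge> 0"
  shows "of_int (2 * x + y + 2 * int k + 4) * ((\<Prod>i<Suc k. afac x y i) * W (x + 2) (y - 1) (Suc k)) =
    fact k * (kap (x + y) * of_int ((x + 1) * (x + 2))) * (W x y (Suc (Suc k)) * (\<Prod>i<k. afac (x + 2) (y - 1) i))"
proof (induction k)
  case 0
  have a: "afac x y 0 = ifact (x + y + 1) * of_int (x + 2 * y + 4) * rfact x * rfact (y + 2)"
    by (simp add: afac_def poch_Suc)
  have w1: "W (x + 2) (y - 1) (Suc 0) = ifact (x + y + 1) * h (Suc 0) (x + y + 1)"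
  proof -
    have "x + 2 + (y - 1) = x + y + 1" by simp
    then show ?thesis by (simp add: W_def ac_simps)
  qed
  have w2: "W x y (Suc (Suc 0)) = ifact (x + y) * ifact (x + y + 1) * of_int (2 * x + y + 4) * of_int (x + 2 * y + 4)
    * rfact (x + 2) * rfact (y + 2) * h (Suc (Suc 0)) (x + y)"
  proof -
    have "{Suc 0..<Suc (Suc 0)} = {Suc 0}" by auto
    then show ?thesis by (simp add: W_def poch_Suc algebra_simps)
  qed
  have f: "rfact x = of_int (x + 1) * of_int (x + 2) * rfact (x + 2)"
    using rfact_rec[of x] rfact_rec[of "x + 1"] by (simp add: add.assoc)
  have hk: "kap (x + y) * h (Suc (Suc 0)) (x + y) = h (Suc 0) (x + y + 1) * of_int (x + y + 1)"
    using h_kap[OF assms] by simp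
  have fa: "ifact (x + y + 1) = of_int (x + y + 1) * ifact (x + y)" by (rule ifact_rec[OF assms])
  have "of_int (2 * x + y + 4) * (afac x y 0 * W (x + 2) (y - 1) (Suc 0)) =
     of_int (x + 1) * of_int (x + 2) * (h (Suc 0) (x + y + 1) * of_int (x + y + 1)) * ifact (x + y) * ifact (x + y + 1)
      * of_int (2 * x + y + 4) * of_int (x + 2 * y + 4) * rfact (x + 2) * rfact (y + 2)"
    unfolding a w1 f fa by (simp only: ac_simps)
  also have "\<dots> = kap (x + y) * (of_int (x + 1) * of_int (x + 2)) * W x y (Suc (Suc 0))"
    unfolding hk[symmetric] w2 by (simp only: ac_simps)
  finally show ?case by (simp only: of_int_mult) simp
next
  case (Suc k)
  define c where "c = (\<lambda>k. of_int (2 * x + y + 2 * int k + 4) :: rat)"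
  have c1: "c (Suc k) = of_int (2 * x + y + 2 * int k + 6)" by (simp add: c_def)
  define e where "e = (if even (x + y + int (Suc (Suc k))) then of_int (x + y + int k + 3) else (1 :: rat))"
  have a: "afac x y (Suc k) = fact (Suc k) * ifact (x + y + int k + 2) * poch (2 * x + y + 2 * int k + 4) (Suc k)
    * poch (x + 2 * y + 2 * int k + 6) (Suc (Suc k)) * rfact (x + 2 * int k + 2) * rfact (y + 2 * int k + 4)"
    unfolding afac_def by (intro arg_cong2[of _ _ _ _ "(*)"] arg_cong[of _ _ rfact] arg_cong[of _ _ ifact] arg_cong2[of _ _ _ _ poch]) auto
  have w1: "wfac (x + 2) (y - 1) k = ifact (x + y + int k + 2) * poch (2 * x + y + 2 * int k + 7) (Suc k)
    * poch (x + 2 * y + 2 * int k + 4) (Suc k) * rfact (x + 2 * int k + 4) * rfact (y + 2 * int k + 1)"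
    unfolding wfac_def by (intro arg_cong2[of _ _ _ _ "(*)"] arg_cong[of _ _ rfact] arg_cong[of _ _ ifact] arg_cong2[of _ _ _ _ poch]) auto
  have w2: "wfac x y (Suc k) = ifact (x + y + int k + 2) * poch (2 * x + y + 2 * int k + 6) (Suc (Suc k))
    * poch (x + 2 * y + 2 * int k + 6) (Suc (Suc k)) * rfact (x + 2 * int k + 4) * rfact (y + 2 * int k + 4)"
    unfolding wfac_def by (intro arg_cong2[of _ _ _ _ "(*)"] arg_cong[of _ _ rfact] arg_cong[of _ _ ifact] arg_cong2[of _ _ _ _ poch]) auto
  have p1: "poch (2 * x + y + 2 * int k + 6) (Suc (Suc k)) = c (Suc k) * poch (2 * x + y + 2 * int k + 7) (Suc k)"
    unfolding c1 using poch_Suc_left[of "2 * x + y + 2 * int k + 6" "Suc k"] by (simp add: add.assoc)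
  have p2: "poch (2 * x + y + 2 * int k + 4) (Suc k) = c k * poch (2 * x + y + 2 * int k + 5) k"
    unfolding c_def using poch_Suc_left[of "2 * x + y + 2 * int k + 4" k] by (simp add: add.assoc)
  have *: "c (Suc k) * (afac x y (Suc k) * wfac (x + 2) (y - 1) k) =
     c k * (of_nat (Suc k) * wfac x y (Suc k) * afac (x + 2) (y - 1) k)"
    unfolding a w1 w2 afac_shift p1 p2 fact_Suc by (simp only: ac_simps)
  have W1: "W (x + 2) (y - 1) (Suc (Suc k)) = W (x + 2) (y - 1) (Suc k) * wfac (x + 2) (y - 1) k * e"
  proof -
    have "x + 2 + (y - 1) + int (Suc k) = x + y + int (Suc (Suc k))" "x + 2 + (y - 1) + int k + 2 = x + y + int k + 3"
      by simp_all
    then show ?thesis unfolding W_Suc[of "x + 2"] e_def by (simp only:)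
  qed
  have W2: "W x y (Suc (Suc (Suc k))) = W x y (Suc (Suc k)) * wfac x y (Suc k) * e"
  proof -
    have "x + y + int (Suc k) + 2 = x + y + int k + 3" by simp
    then show ?thesis unfolding W_Suc[of x y "Suc k"] e_def by (simp only:)
  qed
  have IH: "c k * ((\<Prod>i<Suc k. afac x y i) * W (x + 2) (y - 1) (Suc k)) =
    fact k * (kap (x + y) * of_int ((x + 1) * (x + 2))) * (W x y (Suc (Suc k)) * (\<Prod>i<k. afac (x + 2) (y - 1) i))"
    using Suc.IH unfolding c_def .
  have "c (Suc k) * ((\<Prod>i<Suc (Suc k). afac x y i) * W (x + 2) (y - 1) (Suc (Suc k))) =
    (\<Prod>i<Suc k. afac x y i) * W (x + 2) (y - 1) (Suc k) * e * (c (Suc k) * (afac x y (Suc k) * wfac (x + 2) (y - 1) k))"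
    unfolding W1 prod.lessThan_Suc[of _ "Suc k"] by (simp only: ac_simps)
  also have "\<dots> = c k * ((\<Prod>i<Suc k. afac x y i) * W (x + 2) (y - 1) (Suc k)) * e *
     (of_nat (Suc k) * wfac x y (Suc k) * afac (x + 2) (y - 1) k)"
    unfolding * by (simp only: ac_simps)
  also have "\<dots> = fact (Suc k) * (kap (x + y) * of_int ((x + 1) * (x + 2))) *
     (W x y (Suc (Suc (Suc k))) * (\<Prod>i<Suc k. afac (x + 2) (y - 1) i))"
    unfolding IH unfolding W2 prod.lessThan_Suc[of _ k] fact_Suc by (simp only: ac_simps)
  finally show ?case unfolding c_def .
qed

definition R :: "nat \<Rightarrow> int \<Rightarrow> int \<Rightarrow> rat" where
  "R n x y = Dentry_det x y n / W x y n"

lemma W_swap: "W y x n = W x y n"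
proof -
  have "y + x = x + y" by simp
  then show ?thesis unfolding W_def by (simp add: ac_simps)
qed

lemma R_swap: "R n y x = (-1) ^ n * R n x y"
  by (simp add: R_def W_swap[of y x] Dentry_det_swap[of y x])

text \<open>This is \<open>Dentry_det_desnanot\<close> divided by \<open>W x y (Suc (Suc k))\<close>
  and by the product of the \<open>afac (x + 2) (y - 1) i\<close>. The hypotheses keep all divisors
  positive, also at the shifted arguments.\<close>

theorem R_rec:
  assumes "x \<ge> -1" "y \<ge> 0" "x + y \<ge> 0"
  shows "of_int (2 * x + y + 2 * int k + 4) * R (Suc (Suc k)) x y =
    fact k * (eps (Suc k) (x + y) * of_int (y + 2 * int k + 2) * R (Suc k) x y
      - kap (x + y) * of_int ((x + 1) * (x + 2)) * R (Suc k) (x + 2) (y - 1))"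
proof -
  define c where "c = (of_int (2 * x + y + 2 * int k + 4) :: rat)"
  define q where "q = (\<Prod>i<k. afac (x + 2) (y - 1) i)"
  define q1 where "q1 = (\<Prod>i<Suc k. afac x y i)"
  define w where "w = W x y (Suc (Suc k))"
  have q: "q > 0" unfolding q_def by (intro prod_pos ballI afac_pos) (use assms in auto)
  have w: "w > 0" unfolding w_def by (rule W_pos) (use assms in auto)
  have nz: "W x y (Suc k) \<noteq> 0" "W (x + 2) (y - 1) (Suc k) \<noteq> 0"
    using W_pos[of x y "Suc k"] W_pos[of "x + 2" "y - 1" "Suc k"] assms by auto
  define r r1 r2 where "r = R (Suc (Suc k)) x y" and "r1 = R (Suc k) x y" and "r2 = R (Suc k) (x + 2) (y - 1)"
  have D: "Dentry_det x y (Suc (Suc k)) = r * w" "Dentry_det x y (Suc k) = r1 * W x y (Suc k)"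
    "Dentry_det (x + 2) (y - 1) (Suc k) = r2 * W (x + 2) (y - 1) (Suc k)"
    using nz w by (simp_all add: r_def r1_def r2_def R_def w_def)
  have A: "Af (x + 2) (y - 1) k = q" "Af (x + 2) (y - 1) (Suc k) = q * afac (x + 2) (y - 1) k" "Af x y (Suc k) = q1"
    unfolding q_def q1_def using assms by (simp_all add: Af_eq)
  have "r * w * q = r1 * W x y (Suc k) * (q * afac (x + 2) (y - 1) k) - r2 * W (x + 2) (y - 1) (Suc k) * q1"
    using Dentry_det_desnanot[OF assms(3), of k] unfolding D A .
  then have "c * (r * w * q) = c * (r1 * W x y (Suc k) * (q * afac (x + 2) (y - 1) k) - r2 * W (x + 2) (y - 1) (Suc k) * q1)"
    by (simp only:)
  then have "c * (r * w * q) = r1 * q * (c * (W x y (Suc k) * afac (x + 2) (y - 1) k)) - r2 * (c * (q1 * W (x + 2) (y - 1) (Suc k)))"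
    by (simp only: right_diff_distrib ac_simps)
  also have "\<dots> = fact k * (eps (Suc k) (x + y) * of_int (y + 2 * int k + 2) * r1
      - kap (x + y) * of_int ((x + 1) * (x + 2)) * r2) * (w * q)"
    unfolding c_def W_rec1[OF assms(3)] q1_def W_rec2[OF assms(3)] w_def q_def
    by (simp only: left_diff_distrib right_diff_distrib ac_simps)
  finally have "(c * r) * (w * q) = fact k * (eps (Suc k) (x + y) * of_int (y + 2 * int k + 2) * r1
      - kap (x + y) * of_int ((x + 1) * (x + 2)) * r2) * (w * q)" by (simp only: ac_simps)
  moreover have "w * q \<noteq> 0" using w q by simp
  ultimately show ?thesis unfolding c_def r_def r1_def r2_def by (simp only: mult_cancel_right) simp
qed

subsection \<open>Polynomiality\<close>

text \<open>The number d only bounds the degree and c may be 0, so that cancellation of top terms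
  needs no case distinction.\<close>

definition top_coeff :: "nat \<Rightarrow> rat \<Rightarrow> rat poly \<Rightarrow> bool" where
  "top_coeff d c q \<longleftrightarrow> degree q \<le> d \<and> coeff q d = c"

lemma top_coeffI: "degree q \<le> d \<Longrightarrow> top_coeff d (coeff q d) q"
  by (simp add: top_coeff_def)

lemma top_coeff_mult: "top_coeff d c q \<Longrightarrow> top_coeff d' c' q' \<Longrightarrow> top_coeff (d + d') (c * c') (q * q')"
proof -
  assume a: "top_coeff d c q" "top_coeff d' c' q'"
  have "coeff (q * q') (d + d') = coeff q d * coeff q' d'"
  proof -
    have "(\<Sum>i\<le>d + d'. coeff q i * coeff q' (d + d' - i)) = (\<Sum>i\<in>{d}. coeff q i * coeff q' (d + d' - i))"
    proof (rule sum.mono_neutral_right)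
      show "\<forall>i\<in>{..d + d'} - {d}. coeff q i * coeff q' (d + d' - i) = 0"
      proof
        fix i assume "i \<in> {..d + d'} - {d}"
        then have "i > d \<or> d + d' - i > d'" by auto
        then show "coeff q i * coeff q' (d + d' - i) = 0"
          using a by (auto simp: top_coeff_def coeff_eq_0)
      qed
    qed auto
    then show ?thesis by (simp add: coeff_mult)
  qed
  moreover have "degree (q * q') \<le> d + d'"
    using a degree_mult_le[of q q'] by (simp add: top_coeff_def)
  ultimately show ?thesis using a by (simp add: top_coeff_def)
qed

lemma top_coeff_diff: "top_coeff d c q \<Longrightarrow> top_coeff d c' q' \<Longrightarrow> top_coeff d (c - c') (q - q')"
  by (simp add: top_coeff_def degree_diff_le)

lemma top_coeff_smult: "top_coeff d c q \<Longrightarrow> top_coeff d (a * c) (smult a q)"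
  by (auto simp: top_coeff_def intro: degree_smult_le[THEN order_trans])

lemma top_coeff_linear: "top_coeff 1 a [:b, a:]"
  by (simp add: top_coeff_def)

lemma top_coeff_const: "top_coeff 0 a [:a:]"
  by (simp add: top_coeff_def)

lemma top_coeff_zero: "top_coeff d 0 0"
  by (simp add: top_coeff_def)

lemma top_coeff_shift:
  assumes "top_coeff d c q"
  shows "top_coeff d c (q \<circ>\<^sub>p [:b, 1:])"
proof -
  have "degree (q \<circ>\<^sub>p [:b, 1:]) = degree q" by simp
  moreover have "coeff (q \<circ>\<^sub>p [:b, 1:]) d = coeff q d"
  proof (cases "degree q = d")
    case True
    then show ?thesis using lead_coeff_comp[of "[:b, 1:]" q] by simp
  next
    case False
    then have "degree q < d" using assms by (simp add: top_coeff_def)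
    then show ?thesis by (simp add: coeff_eq_0)
  qed
  ultimately show ?thesis using assms by (simp add: top_coeff_def)
qed

lemma top_coeff_degree_drop:
  assumes "top_coeff (Suc d) 0 q"
  shows "degree q \<le> d"
proof (rule ccontr)
  assume "\<not> degree q \<le> d"
  then have "degree q = Suc d" using assms by (simp add: top_coeff_def)
  then have "lead_coeff q = 0" using assms by (simp add: top_coeff_def)
  then have "q = 0" by (simp only: leading_coeff_0_iff)
  with \<open>degree q = Suc d\<close> show False by simp
qed

lemma top_coeff_div:
  assumes "[:a, b:] * q = r" "b \<noteq> 0" "top_coeff (Suc d) c r"
  shows "top_coeff d (c / b) q"
proof -
  have deg: "degree q \<le> d"
  proof (cases "q = 0")
    case False
    then have "degree r = Suc (degree q)"
      using assms(1,2) by (auto simp: degree_mult_eq simp del: mult_pCons_left)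
    then show ?thesis using assms(3) by (simp add: top_coeff_def)
  qed simp
  have "top_coeff (1 + d) (b * coeff q d) ([:a, b:] * q)"
    by (intro top_coeff_mult top_coeff_linear top_coeffI deg)
  then have "c = b * coeff q d" using assms(1,3) by (simp add: top_coeff_def del: mult_pCons_left)
  then show ?thesis using deg assms(2) by (simp add: top_coeff_def)
qed

lemma degree_div:
  fixes q r :: "rat poly"
  assumes "[:a, b:] * q = r" "b \<noteq> 0" "degree r \<le> Suc d"
  shows "degree q \<le> d"
  using top_coeff_div[OF assms(1,2) top_coeffI[OF assms(3)]] by (simp add: top_coeff_def)

text \<open>Stated for positive arguments because \<open>rec_poly'_eval\<close> is available only
  there.\<close>

lemma poly_eqI_nat:
  fixes p q :: "rat poly"
  assumes "\<And>x::nat. x \<ge> 1 \<Longrightarrow> poly p (of_nat x) = poly q (of_nat x)"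
  shows "p = q"
proof (rule ccontr)
  assume "p \<noteq> q"
  then have "finite {x. poly (p - q) x = 0}" by (intro poly_roots_finite) simp
  moreover have "of_nat ` {1..} \<subseteq> {x. poly (p - q) x = 0}" using assms by auto
  ultimately have "finite (of_nat ` {1..} :: rat set)" by (rule finite_subset[rotated])
  then have "finite {1 :: nat..}" by (rule finite_imageD) (simp add: inj_on_def)
  then show False using infinite_Ici[of "1 :: nat"] by simp
qed

section \<open>The case n = 1\<close>

fun base_poly :: "nat \<Rightarrow> rat poly" where
  "base_poly 0 = 0"
| "base_poly (Suc 0) = 1"
| "base_poly (Suc (Suc m)) = [:of_nat (m + 2), 1:] * (base_poly m \<circ>\<^sub>p [:1, 1:])
     + smult (if even m then 1 else 2) (\<Prod>i<(m + 1) div 2. [:of_nat (i + 2), 1:])"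

lemma degree_base_poly: "degree (base_poly m) \<le> (m - 1) div 2"
proof (induction m rule: base_poly.induct)
  case (3 m)
  have d: "degree (\<Prod>i<(m + 1) div 2. [:of_nat (i + 2), 1 :: rat:]) \<le> (m + 1) div 2"
    using degree_prod_sum_le[of "{..<(m + 1) div 2}" "\<lambda>i. [:of_nat (i + 2), 1 :: rat:]"] by simp
  show ?case
  proof (cases m)
    case 0
    then show ?thesis by simp
  next
    case (Suc l)
    have "degree ([:of_nat (m + 2), 1:] * (base_poly m \<circ>\<^sub>p [:1, 1:])) \<le> 1 + (m - 1) div 2"
      by (rule order_trans[OF degree_mult_le]) (use 3 in \<open>simp del: mult_pCons_left\<close>)
    also have "\<dots> = (m + 1) div 2" using Suc by simp
    finally have "degree (base_poly (Suc (Suc m))) \<le> (m + 1) div 2"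
      unfolding base_poly.simps
      by (intro degree_add_le order_trans[OF degree_smult_le] d)
    then show ?thesis by simp
  qed
qed simp_all

lemma ifact_ratio: "ifact (int (a + l)) = (\<Prod>i<l. of_nat (a + 1 + i)) * ifact (int a)"
proof (induction l)
  case (Suc l)
  have "ifact (int (a + Suc l)) = of_nat (a + 1 + l) * ifact (int (a + l))"
    using ifact_rec[of "int (a + l)"] by (simp add: ac_simps)
  then show ?case using Suc by simp
qed simp

lemma rfact_nat: "rfact (int a) = 1 / fact a"
  by (simp add: rfact_def)

lemma ifact_nat: "ifact (int a) = fact a"
  by (simp add: ifact_def)

lemma R_1: "R (Suc 0) x y = (psum (x + y) y - psum (x + y) x) / (ifact (x + y) * h (Suc 0) (x + y))"
  by (simp add: R_def Dentry_det_def W_def Dentry_def)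

text \<open>Passing from (x+1,x+1+m) to (x,x+m+2) keeps the sum s of the arguments and adds one
  binomial coefficient at each end of the range. By symmetry and Pascal's rule these add up to
  \<open>bin (s + 1) (int x + 1)\<close>, which after normalisation is the product in
  \<open>base_poly\<close>; the factor x+m+2 adjusts the factorial.\<close>

lemma R_1_base: "R (Suc 0) (int x) (int x + int m) * fact (x + m) = poly (base_poly m) (of_nat x)"
proof (induction m arbitrary: x rule: base_poly.induct)
  case 1
  show ?case by (simp add: R_1)
next
  case 2
  have s: "int x + (int x + 1) = int (2 * x + 1)" by simp
  have "psum (int (2 * x + 1)) (int x + 1) - psum (int (2 * x + 1)) (int x) = bin (int (2 * x + 1)) (int x + 1)"
    using psum_rec[of "int (2 * x + 1)" "int x + 1"] by simp
  also have "\<dots> = ifact (int (2 * x + 1)) * rfact (int (x + 1)) * rfact (int x)"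
    unfolding bin_def by (intro arg_cong2[of _ _ _ _ "(*)"] arg_cong[of _ _ rfact]) auto
  finally have p: "psum (int (2 * x + 1)) (int x + 1) - psum (int (2 * x + 1)) (int x) = ifact (int (2 * x + 1)) * rfact (int (x + 1)) * rfact (int x)" .
  have "(2 * int x + 1) div 2 = int x" by simp
  then have h: "h (Suc 0) (int (2 * x + 1)) = 1 / fact x" by (simp add: h_def ifact_def)
  have "R (Suc 0) (int x) (int x + 1) = rfact (int (x + 1)) * rfact (int x) * fact x"
    unfolding R_1 s p h using ifact_pos[of "int (2 * x + 1)"] by simp
  then have "R (Suc 0) (int x) (int x + 1) = 1 / fact (x + 1)" unfolding rfact_nat by simp
  then show ?case by simp
next
  case (3 m)
  define s where "s = 2 * int x + int m + 2"
  have s0: "s \<ge> 0" by (simp add: s_def)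
  define fs where "fs = ifact s"
  define hs where "hs = h (Suc 0) s"
  have nz: "fs \<noteq> 0" "hs \<noteq> 0" using ifact_pos[of s] h_pos[OF s0, of "Suc 0"] by (simp_all add: fs_def hs_def)
  have IH: "R (Suc 0) (int x + 1) (int x + 1 + int m) * fact (x + 1 + m) = poly (base_poly m) (of_nat x + 1)"
    using 3[of "x + 1"] by (simp add: ac_simps)
  have s1: "int x + 1 + (int x + 1 + int m) = s" "int x + (int x + int (Suc (Suc m))) = s"
    by (simp_all add: s_def)
  have R1: "R (Suc 0) (int x + 1) (int x + 1 + int m) = (psum s (int x + int m + 1) - psum s (int x + 1)) / (fs * hs)"
    unfolding R_1 s1 fs_def hs_def by (simp add: ac_simps)
  have R2: "R (Suc 0) (int x) (int x + int (Suc (Suc m))) = (psum s (int x + int m + 2) - psum s (int x)) / (fs * hs)"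
    unfolding R_1 s1 fs_def hs_def by (simp add: ac_simps)
  have sy: "s + 1 - (int x + 1) = int (x + m + 2)" "s - (int x + int m + 2) = int x" "s - int x = int (x + m + 2)"
     "int x + int m + 2 = int (x + m + 2)" "int x + 1 = int (x + 1)"
    by (simp_all add: s_def)
  have "(psum s (int x + int m + 2) - psum s (int x)) - (psum s (int x + int m + 1) - psum s (int x + 1)) =
    bin s (int x + 1) + bin s (int x + int m + 2)"
  proof -
    have "int x + int m + 2 - 1 = int x + int m + 1" by simp
    then have "psum s (int x + int m + 2) = psum s (int x + int m + 1) + bin s (int x + int m + 2)"
      using psum_rec[of s "int x + int m + 2"] by (simp only:)
    then show ?thesis using psum_rec[of s "int x + 1"] by simp
  qed
  also have "bin s (int x + int m + 2) = bin s (int x)"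
    unfolding bin_def sy(2,3) unfolding sy(4) by (simp only: ac_simps)
  also have "bin s (int x + 1) + bin s (int x) = bin (s + 1) (int x + 1)"
    using bin_pascal[OF s0, of "int x + 1"] by simp
  also have "\<dots> = of_int (s + 1) * fs * rfact (int (x + 1)) * rfact (int (x + m + 2))"
    unfolding bin_def sy(1) ifact_rec[OF s0] fs_def unfolding sy ..
  finally have d: "(psum s (int x + int m + 2) - psum s (int x)) - (psum s (int x + int m + 1) - psum s (int x + 1)) =
     of_int (s + 1) * fs * rfact (int (x + 1)) * rfact (int (x + m + 2))" .
  have "R (Suc 0) (int x) (int x + int (Suc (Suc m))) - R (Suc 0) (int x + 1) (int x + 1 + int m) =
     of_int (s + 1) * rfact (int (x + 1)) * rfact (int (x + m + 2)) / hs"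
    unfolding R1 R2 diff_divide_distrib[symmetric] d using nz by simp
  then have "(R (Suc 0) (int x) (int x + int (Suc (Suc m))) - R (Suc 0) (int x + 1) (int x + 1 + int m)) * fact (x + m + 2)
     = of_int (s + 1) * rfact (int (x + 1)) * rfact (int (x + m + 2)) / hs * fact (x + m + 2)"
    by (simp only:)
  also have "\<dots> = of_int (s + 1) / hs * rfact (int (x + 1))"
    unfolding rfact_nat[of "x + m + 2"] by simp
  also have "of_int (s + 1) / hs = (if even m then 1 else 2) * ifact (int (x + 1 + (m + 1) div 2))"
  proof (cases "even m")
    case True
    then have "s div 2 = int (x + 1 + (m + 1) div 2)" "even s" by (auto simp: s_def elim!: evenE)
    moreover have "of_int (s + 1) \<noteq> (0 :: rat)" using s0 by (simp only: of_int_eq_0_iff)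
    ultimately show ?thesis using True by (simp add: hs_def h_def)
  next
    case False
    then obtain l where l: "m = 2 * l + 1" by (auto elim: oddE)
    then have sl: "s = 2 * int (x + l + 1) + 1" by (simp add: s_def)
    then have "odd s" "s div 2 = int (x + l + 1)" by (simp, presburger)
    then have "hs = 1 / ifact (int (x + l + 1))" by (simp add: hs_def h_def)
    moreover have "of_int (s + 1) = (2 :: rat) * of_int (int (x + l + 1) + 1)" using sl by simp
    moreover have "int (x + 1 + (m + 1) div 2) = int (x + l + 1) + 1" using l by simp
    ultimately show ?thesis using False ifact_rec[of "int (x + l + 1)"] by simp
  qed
  also have "ifact (int (x + 1 + (m + 1) div 2)) = (\<Prod>i<(m + 1) div 2. of_nat (x + 1 + 1 + i)) * ifact (int (x + 1))"
    by (rule ifact_ratio)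
  also have "(if even m then 1 else 2) * ((\<Prod>i<(m + 1) div 2. of_nat (x + 1 + 1 + i)) * ifact (int (x + 1))) * rfact (int (x + 1)) =
    poly (smult (if even m then 1 else 2) (\<Prod>i<(m + 1) div 2. [:of_nat (i + 2), 1:])) (of_nat x)"
    unfolding rfact_nat ifact_nat by (simp add: poly_prod ac_simps)
  finally have "R (Suc 0) (int x) (int x + int (Suc (Suc m))) * fact (x + m + 2) =
     R (Suc 0) (int x + 1) (int x + 1 + int m) * fact (x + m + 2) +
     poly (smult (if even m then 1 else 2) (\<Prod>i<(m + 1) div 2. [:of_nat (i + 2), 1:])) (of_nat x)"
    by (simp only: left_diff_distrib diff_eq_eq add.commute)
  also have "fact (x + m + 2) = of_nat (x + m + 2) * (fact (x + 1 + m) :: rat)" by (simp add: ac_simps)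
  also have "R (Suc 0) (int x + 1) (int x + 1 + int m) * (of_nat (x + m + 2) * fact (x + 1 + m)) =
     of_nat (x + m + 2) * (R (Suc 0) (int x + 1) (int x + 1 + int m) * fact (x + 1 + m))" by (simp only: ac_simps)
  also note IH
  finally show ?case by (simp add: poly_pcompose algebra_simps)
qed

text \<open>The last conjunct is the same formula at x = -1 and m = 3, where (x+m)! is 2.\<close>

definition represents :: "nat \<Rightarrow> (nat \<Rightarrow> rat poly) \<Rightarrow> bool" where
  "represents n p \<longleftrightarrow> (\<forall>m x. R n (int x) (int x + int m) * fact (x + m) = poly (p m) (of_nat x))
     \<and> R n (-1) 2 = poly (p 3) (-1) / 2"

text \<open>The value at \<open>x = -1\<close> is what \<open>shift_poly_eval\<close> needs for \<open>m = x = 0\<close>. In the two invariants below, the periodicity of the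
  top coefficients for even \<open>n\<close> is what makes the degree drop in the step to \<open>n + 1\<close>.\<close>
definition inv_odd :: "nat \<Rightarrow> rat \<Rightarrow> (nat \<Rightarrow> rat poly) \<Rightarrow> bool" where
  "inv_odd n c p \<longleftrightarrow> p 0 = 0 \<and> p 3 = smult c [:of_nat (2 * n + 5), 3:] \<and> (\<forall>m. degree (p m) \<le> (m - 1) div 2)"

definition inv_even :: "nat \<Rightarrow> rat \<Rightarrow> (nat \<Rightarrow> rat poly) \<Rightarrow> bool" where
  "inv_even n c p \<longleftrightarrow> p 0 = [:c:] \<and> p 3 = smult c [:of_nat (2 * n + 1), 1:] \<and> (\<forall>m. degree (p m) \<le> m div 2)
     \<and> (\<forall>m. coeff (p (m + 3)) ((m + 3) div 2) = coeff (p m) (m div 2)) \<and> coeff (p 1) 0 = coeff (p 2) 1"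

lemma base_poly_3: "base_poly 3 = [:7, 3:]"
  by (simp add: numeral_3_eq_3 pcompose_pCons one_pCons)

lemma represents_base: "represents 1 base_poly"
proof -
  have "{0..2 :: int} = {0, 1, 2}" "{0..-1 :: int} = {}" by auto
  then have "R 1 (-1) 2 = 2"
    by (simp add: R_1 psum_def bin_def rfact_def ifact_def h_def)
  then show ?thesis
    using R_1_base by (simp add: represents_def base_poly_3)
qed

lemma inv_odd_base: "inv_odd 1 1 base_poly"
  using degree_base_poly by (simp add: inv_odd_def base_poly_3)

section \<open>The recurrences as polynomial identities, and the induction on n\<close>

definition eps_poly :: "nat \<Rightarrow> nat \<Rightarrow> rat poly" where
  "eps_poly n m = (if even (m + n) then [:1:] else [:of_nat (m + n + 1), 2:])"

definition kap_nat :: "nat \<Rightarrow> rat" where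
  "kap_nat m = (if even m then 1 else 2)"

text \<open>\<open>shift_poly n p m\<close> represents \<open>(x + 1) (x + 2) (x + m)! R\<^sub>n(x + 2, x + m - 1)\<close>; for \<open>m < 3\<close> the
  antisymmetry of \<open>R\<^sub>n\<close> is needed to get back to nonnegative differences.\<close>
definition shift_poly :: "nat \<Rightarrow> (nat \<Rightarrow> rat poly) \<Rightarrow> nat \<Rightarrow> rat poly" where
  "shift_poly n p m =
     (if m = 0 then smult ((-1) ^ n) (p 3 \<circ>\<^sub>p [:-1, 1:])
      else if m = 1 then smult ((-1) ^ n) ([:1, 1:] * p 2)
      else if m = 2 then smult ((-1) ^ n) ([:1, 1:] * [:2, 1:] * (p 1 \<circ>\<^sub>p [:1, 1:]))
      else [:1, 1:] * [:2, 1:] * [:of_nat m, 1:] * (p (m - 3) \<circ>\<^sub>p [:2, 1:]))"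

definition rec_poly :: "nat \<Rightarrow> (nat \<Rightarrow> rat poly) \<Rightarrow> nat \<Rightarrow> rat poly" where
  "rec_poly n p m = [:of_nat (m + 2 * n), 1:] * eps_poly n m * p m - smult (kap_nat m) (shift_poly n p m)"

text \<open>From \<open>R_rec\<close> at (x+m,x), turned back by antisymmetry; the signs for n and
  n+1 differ, hence the exchanged order of the two terms. The shifted term becomes R at (x-1,x+m+2),
  that is \<open>p (m + 3)\<close> at x-1, and its quadratic coefficient completes (x+m)! to
  (x+m+2)!.\<close>

definition rec_poly' :: "nat \<Rightarrow> (nat \<Rightarrow> rat poly) \<Rightarrow> nat \<Rightarrow> rat poly" where
  "rec_poly' n p m = smult (kap_nat m) (p (m + 3) \<circ>\<^sub>p [:-1, 1:]) - [:of_nat (2 * n), 1:] * eps_poly n m * p m"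

lemma representsD:
  "represents n p \<Longrightarrow> R n (int x) (int x + int m) * fact (x + m) = poly (p m) (of_nat x)"
  by (simp add: represents_def)

lemma eps_poly_eval: "eps n (int x + (int x + int m)) = poly (eps_poly n m) (of_nat x)"
  by (simp add: eps_def eps_poly_def)

lemma kap_nat_eq: "kap (int x + (int x + int m)) = kap_nat m"
  by (simp add: kap_def kap_nat_def)

lemma neg_one_square: "(-1) ^ n * ((-1) ^ n * a) = (a :: rat)"
  by (simp flip: mult.assoc power_add)

text \<open>The arguments (x+2,x+m-1) have difference m-3; for m < 3 antisymmetry turns it into 3-m.
  The quadratic factor and (x+m)! together contain the factorial that \<open>represents\<close> asks
  for. Only m = x = 0 leaves the natural numbers.\<close>

lemma shift_poly_eval:
  assumes "represents n p"
  shows "of_int ((int x + 1) * (int x + 2)) * R n (int x + 2) (int x + int m - 1) * fact (x + m) =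
    poly (shift_poly n p m) (of_nat x)"
proof -
  consider "m = 0" "x = 0" | z where "m = 0" "x = Suc z" | "m = 1" | "m = 2" | q where "m = q + 3"
  proof -
    have "m = 0 \<or> m = 1 \<or> m = 2 \<or> m = (m - 3) + 3" by linarith
    then show ?thesis using that by (metis not0_implies_Suc)
  qed
  then show ?thesis
  proof cases
    case 1
    have "R n 2 (-1) = (-1) ^ n * R n (-1) 2" by (rule R_swap)
    then show ?thesis using 1 assms by (simp add: represents_def shift_poly_def poly_pcompose)
  next
    case 2
    have swap: "R n (int z + 3) (int z) = (-1) ^ n * R n (int z) (int z + int 3)"
      using R_swap[of n "int z + 3" "int z"] by simp
    have f: "of_int ((int z + 2) * (int z + 3)) * fact (Suc z) = (fact (z + 3) :: rat)"
      by (simp add: numeral_3_eq_3 algebra_simps)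
    have "of_int ((int z + 2) * (int z + 3)) * R n (int z + 3) (int z) * fact (Suc z) =
       (-1) ^ n * (R n (int z) (int z + int 3) * fact (z + 3))"
      unfolding swap f[symmetric] by (simp only: ac_simps)
    then show ?thesis
      using 2 representsD[OF assms, of z 3] by (simp add: shift_poly_def poly_pcompose ac_simps)
  next
    case 3
    have swap: "R n (int x + 2) (int x) = (-1) ^ n * R n (int x) (int x + int 2)"
      using R_swap[of n "int x + 2" "int x"] by simp
    have f: "of_int ((int x + 1) * (int x + 2)) * fact (x + 1) = of_int (int x + 1) * (fact (x + 2) :: rat)"
      by (simp add: numeral_2_eq_2 algebra_simps)
    have "of_int ((int x + 1) * (int x + 2)) * R n (int x + 2) (int x) * fact (x + 1) =
       (of_int ((int x + 1) * (int x + 2)) * fact (x + 1)) * R n (int x + 2) (int x)"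
      by (simp only: ac_simps)
    also have "\<dots> = (-1) ^ n * (of_int (int x + 1) * (R n (int x) (int x + int 2) * fact (x + 2)))"
      unfolding swap f by (simp only: ac_simps)
    finally have "of_int ((int x + 1) * (int x + 2)) * R n (int x + 2) (int x) * fact (x + 1) =
       (-1) ^ n * (of_int (int x + 1) * (R n (int x) (int x + int 2) * fact (x + 2)))" .
    then show ?thesis
      unfolding representsD[OF assms] using 3 by (simp add: shift_poly_def algebra_simps)
  next
    case 4
    have "R n (int x + 2) (int x + 1) = (-1) ^ n * R n (int (x + 1)) (int (x + 1) + int 1)"
      using R_swap[of n "int x + 2" "int x + 1"] by (simp add: ac_simps)
    then have "of_int ((int x + 1) * (int x + 2)) * R n (int x + 2) (int x + 1) * fact (x + 2) =
       (-1) ^ n * (of_int ((int x + 1) * (int x + 2)) * (R n (int (x + 1)) (int (x + 1) + int 1) * fact (x + 1 + 1)))"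
      by simp
    then show ?thesis
      using 4 unfolding representsD[OF assms] by (simp add: shift_poly_def poly_pcompose algebra_simps)
  next
    case 5
    have f: "fact (x + (q + 3)) = of_nat (x + (q + 3)) * (fact (x + 2 + q) :: rat)"
      by (simp add: numeral_3_eq_3 ac_simps)
    have sh: "R n (int x + 2) (int x + int (q + 3) - 1) = R n (int (x + 2)) (int (x + 2) + int q)"
      by (simp add: ac_simps)
    have "of_int ((int x + 1) * (int x + 2)) * R n (int x + 2) (int x + int (q + 3) - 1) * fact (x + (q + 3)) =
       of_int ((int x + 1) * (int x + 2)) * of_nat (x + (q + 3)) * (R n (int (x + 2)) (int (x + 2) + int q) * fact (x + 2 + q))"
      unfolding f sh by (simp only: ac_simps)
    also have "\<dots> = poly (shift_poly n p m) (of_nat x)"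
      unfolding representsD[OF assms] 5 by (simp add: shift_poly_def poly_pcompose algebra_simps)
    finally show ?thesis unfolding 5 .
  qed
qed

lemma rec_poly_eval:
  assumes "represents (Suc k) p"
  shows "poly [:of_nat (m + 2 * k + 4), 3:] (of_nat x) * (R (Suc (Suc k)) (int x) (int x + int m) * fact (x + m)) =
    fact k * poly (rec_poly (Suc k) p m) (of_nat x)"
proof -
  have e: "of_int (2 * int x + (int x + int m) + 2 * int k + 4) = poly [:of_nat (m + 2 * k + 4), 3:] (of_nat x :: rat)"
    "of_int (int x + int m + 2 * int k + 2) = poly [:of_nat (m + 2 * Suc k), 1:] (of_nat x :: rat)"
    by simp_all
  have rr: "poly [:of_nat (m + 2 * k + 4), 3:] (of_nat x) * R (Suc (Suc k)) (int x) (int x + int m) =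
    fact k * (poly (eps_poly (Suc k) m) (of_nat x) * poly [:of_nat (m + 2 * Suc k), 1:] (of_nat x) * R (Suc k) (int x) (int x + int m)
      - kap_nat m * of_int ((int x + 1) * (int x + 2)) * R (Suc k) (int x + 2) (int x + int m - 1))"
    by (rule R_rec[of "int x" "int x + int m" k, unfolded e eps_poly_eval kap_nat_eq]) simp_all
  have "poly [:of_nat (m + 2 * k + 4), 3:] (of_nat x) * (R (Suc (Suc k)) (int x) (int x + int m) * fact (x + m)) =
    fact k * (poly (eps_poly (Suc k) m) (of_nat x) * poly [:of_nat (m + 2 * Suc k), 1:] (of_nat x) * (R (Suc k) (int x) (int x + int m) * fact (x + m))
      - kap_nat m * (of_int ((int x + 1) * (int x + 2)) * R (Suc k) (int x + 2) (int x + int m - 1) * fact (x + m)))"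
    unfolding mult.assoc[symmetric] rr by (simp only: left_diff_distrib right_diff_distrib mult.assoc)
  then show ?thesis
    unfolding representsD[OF assms] shift_poly_eval[OF assms]
    by (simp only: rec_poly_def poly_diff poly_mult poly_smult ac_simps)
qed

lemma rec_poly'_eval:
  assumes "represents (Suc k) p" "x \<ge> 1"
  shows "poly [:of_nat (2 * m + 2 * k + 4), 3:] (of_nat x) * (R (Suc (Suc k)) (int x) (int x + int m) * fact (x + m)) =
    fact k * poly (rec_poly' (Suc k) p m) (of_nat x)"
proof -
  obtain z where z: "x = Suc z" using assms(2) by (cases x) auto
  define r where "r = R (Suc (Suc k)) (int x) (int x + int m)"
  define r1 where "r1 = R (Suc k) (int x) (int x + int m)"
  define r2 where "r2 = R (Suc k) (int z) (int z + int (m + 3))"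
  define sg where "sg = ((-1) ^ k :: rat)"
  have swap: "R (Suc (Suc k)) (int x + int m) (int x) = sg * r"
    "R (Suc k) (int x + int m) (int x) = - sg * r1"
    "R (Suc k) (int x + int m + 2) (int x - 1) = - sg * r2"
    using R_swap[of "Suc (Suc k)" "int x + int m" "int x"] R_swap[of "Suc k" "int x + int m" "int x"]
      R_swap[of "Suc k" "int x + int m + 2" "int x - 1"]
    by (simp_all add: r_def r1_def r2_def sg_def z ac_simps)
  have e: "eps (Suc k) (int x + int m + int x) = poly (eps_poly (Suc k) m) (of_nat x)"
    "kap (int x + int m + int x) = kap_nat m"
    using eps_poly_eval[of "Suc k" x m] kap_nat_eq[of x m] by (simp_all add: ac_simps)
  define a b c f where "a = poly [:of_nat (2 * m + 2 * k + 4), 3:] (of_nat x :: rat)"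
    and "b = poly [:of_nat (2 * Suc k), 1:] (of_nat x :: rat)"
    and "c = (of_int ((int x + int m + 1) * (int x + int m + 2)) :: rat)"
    and "f = (fact (x + m) :: rat)"
  have abc: "of_int (2 * (int x + int m) + int x + 2 * int k + 4) = a"
    "of_int (int x + 2 * int k + 2) = b"
    by (simp_all add: a_def b_def)
  have "a * (sg * r) = fact k * (poly (eps_poly (Suc k) m) (of_nat x) * b * (- sg * r1) - kap_nat m * c * (- sg * r2))"
    using R_rec[of "int x + int m" "int x" k] unfolding swap e abc c_def[symmetric] by simp
  then have "sg * (a * r) = sg * (fact k * (kap_nat m * c * r2 - poly (eps_poly (Suc k) m) (of_nat x) * b * r1))"
    by (simp add: algebra_simps)
  then have "sg * (sg * (a * r)) = sg * (sg * (fact k * (kap_nat m * c * r2 - poly (eps_poly (Suc k) m) (of_nat x) * b * r1)))"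
    by (rule arg_cong)
  then have "a * r = fact k * (kap_nat m * c * r2 - poly (eps_poly (Suc k) m) (of_nat x) * b * r1)"
    unfolding sg_def neg_one_square .
  then have "a * r * f = fact k * (kap_nat m * c * r2 - poly (eps_poly (Suc k) m) (of_nat x) * b * r1) * f"
    by (simp only:)
  then have "a * r * f = fact k * (kap_nat m * (r2 * (c * f)) - b * poly (eps_poly (Suc k) m) (of_nat x) * (r1 * f))"
    by (simp only: left_diff_distrib right_diff_distrib ac_simps)
  moreover have "c * f = fact (z + (m + 3))"
    by (simp add: c_def f_def z numeral_3_eq_3 algebra_simps)
  moreover have "r2 * fact (z + (m + 3)) = poly (p (m + 3)) (of_nat z)" "r1 * f = poly (p m) (of_nat x)"
    unfolding r2_def r1_def f_def by (rule representsD[OF assms(1)])+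
  moreover have "poly (p (m + 3)) (of_nat z) = poly (p (m + 3) \<circ>\<^sub>p [:-1, 1:]) (of_nat x)"
    by (simp add: poly_pcompose z)
  ultimately have "a * r * f = fact k * (kap_nat m * poly (p (m + 3) \<circ>\<^sub>p [:-1, 1:]) (of_nat x)
     - b * poly (eps_poly (Suc k) m) (of_nat x) * poly (p m) (of_nat x))"
    by simp
  then show ?thesis
    unfolding a_def b_def f_def r_def rec_poly'_def by (simp only: poly_diff poly_mult poly_smult mult.assoc)
qed

text \<open>For m > 0 the linear factors of the two recurrences differ by the constant m, so
  subtracting and dividing by m defines the next polynomial. For m = 0 the factors agree, and the
  quotient \<open>q0\<close> has to be supplied. Both product identities are passed on for the
  comparison of top coefficients.\<close>

lemma rec_step:
  assumes rep: "represents (Suc k) p"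
    and q0: "[:of_nat (2 * k + 4), 3:] * q0 = smult (fact k) (rec_poly (Suc k) p 0)"
  obtains p' where "p' 0 = q0" "represents (Suc (Suc k)) p'"
    "\<And>m. [:of_nat (m + 2 * k + 4), 3:] * p' m = smult (fact k) (rec_poly (Suc k) p m)"
    "\<And>m. m > 0 \<Longrightarrow> [:of_nat (2 * m + 2 * k + 4), 3:] * p' m = smult (fact k) (rec_poly' (Suc k) p m)"
proof -
  define r where "r = (\<lambda>m x. R (Suc (Suc k)) (int x) (int x + int m) * fact (x + m))"
  define p' where "p' = (\<lambda>m. if m = 0 then q0 else smult (fact k / of_nat m) (rec_poly' (Suc k) p m - rec_poly (Suc k) p m))"
  have r1: "poly [:of_nat (m + 2 * k + 4), 3:] (of_nat x) * r m x = fact k * poly (rec_poly (Suc k) p m) (of_nat x)" for m x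
    unfolding r_def by (rule rec_poly_eval[OF rep])
  have r2: "poly [:of_nat (2 * m + 2 * k + 4), 3:] (of_nat x) * r m x = fact k * poly (rec_poly' (Suc k) p m) (of_nat x)"
    if "x \<ge> 1" for m x
    unfolding r_def by (rule rec_poly'_eval[OF rep that])
  have r: "r m x = poly (p' m) (of_nat x)" if "m > 0" "x \<ge> 1" for m x
  proof -
    have "of_nat m * r m x = fact k * poly (rec_poly' (Suc k) p m - rec_poly (Suc k) p m) (of_nat x)"
      using r1[of m x] r2[OF that(2), of m] by (simp add: algebra_simps)
    then show ?thesis using that(1) by (simp add: p'_def field_simps)
  qed
  have L1: "[:of_nat (m + 2 * k + 4), 3:] * p' m = smult (fact k) (rec_poly (Suc k) p m)" for m
  proof (cases "m = 0")
    case True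
    then show ?thesis using q0 by (simp add: p'_def del: mult_pCons_left)
  next
    case False
    show ?thesis
    proof (rule poly_eqI_nat)
      fix x :: nat assume "x \<ge> 1"
      then show "poly ([:of_nat (m + 2 * k + 4), 3:] * p' m) (of_nat x) = poly (smult (fact k) (rec_poly (Suc k) p m)) (of_nat x)"
        using r1[of m x] r[of m x] False unfolding poly_mult poly_smult by simp
    qed
  qed
  have L2: "[:of_nat (2 * m + 2 * k + 4), 3:] * p' m = smult (fact k) (rec_poly' (Suc k) p m)" if "m > 0" for m
  proof (rule poly_eqI_nat)
    fix x :: nat assume "x \<ge> 1"
    then show "poly ([:of_nat (2 * m + 2 * k + 4), 3:] * p' m) (of_nat x) = poly (smult (fact k) (rec_poly' (Suc k) p m)) (of_nat x)"
      using r2[of x m] r[of m x] that unfolding poly_mult poly_smult by simp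
  qed
  \<comment> \<open>The subtraction covers only m > 0 and x > 0. The first recurrence settles all
    cases, since its linear factor is positive on the natural numbers.\<close>
  have "r m x = poly (p' m) (of_nat x)" for m x
  proof -
    have "poly [:of_nat (m + 2 * k + 4), 3:] (of_nat x) * r m x = poly [:of_nat (m + 2 * k + 4), 3:] (of_nat x) * poly (p' m) (of_nat x)"
      using r1[of m x] arg_cong[OF L1[of m], of "\<lambda>q. poly q (of_nat x)"] by (simp only: poly_mult poly_smult)
    moreover have "poly [:of_nat (m + 2 * k + 4), 3:] (of_nat x) > (0 :: rat)"
      by (simp add: add_pos_nonneg)
    ultimately show ?thesis by simp
  qed
  \<comment> \<open>At x = -1 the factor x+1 removes the shifted term from the recurrence and from
    \<open>rec_poly\<close>; the linear factor on the left and the one in the remaining term both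
    equal 2k+4.\<close>
  moreover have "R (Suc (Suc k)) (-1) 2 = poly (p' 3) (-1) / 2"
  proof -
    have nz: "of_nat (2 * k + 4) \<noteq> (0 :: rat)" by (simp only: of_nat_eq_0_iff)
    have e: "eps (Suc k) 1 = poly (eps_poly (Suc k) 3) (-1)"
      by (simp add: eps_def eps_poly_def)
    have "of_nat (2 * k + 4) * R (Suc (Suc k)) (-1) 2 = fact k * (eps (Suc k) 1 * of_nat (2 * k + 4) * R (Suc k) (-1) 2)"
      using R_rec[of "-1" 2 k] by (simp add: ac_simps)
    also have "\<dots> = fact k * (of_nat (2 * k + 4) * poly (eps_poly (Suc k) 3) (-1) * poly (p 3) (-1)) / 2"
      using rep unfolding e represents_def by simp
    also have "of_nat (2 * k + 4) * poly (eps_poly (Suc k) 3) (-1) * poly (p 3) (-1) = poly (rec_poly (Suc k) p 3) (-1)"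
      by (simp add: rec_poly_def shift_poly_def algebra_simps)
    also have "fact k * poly (rec_poly (Suc k) p 3) (-1) = of_nat (2 * k + 4) * poly (p' 3) (-1)"
    proof -
      have "poly [:of_nat (3 + 2 * k + 4), 3:] (-1) = (of_nat (2 * k + 4) :: rat)" by simp
      then show ?thesis
        using arg_cong[OF L1[of 3], of "\<lambda>q. poly q (-1)"] by (simp only: poly_mult poly_smult)
    qed
    finally show ?thesis using nz by simp
  qed
  ultimately have "represents (Suc (Suc k)) p'"
    by (simp add: represents_def r_def)
  moreover have "p' 0 = q0" by (simp add: p'_def)
  ultimately show ?thesis using L1 L2 that by blast
qed

text \<open>The prescribed \<open>p 3\<close> makes the division for m = 0 exact, with constant
  quotient. For m > 0 the top coefficient of \<open>p' m\<close> is read off from the second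
  recurrence and that of \<open>p' (m + 3)\<close> from the first; both are the same combination of
  the top coefficients of \<open>p m\<close> and \<open>p (m + 3)\<close>, whence the
  periodicity.\<close>

lemma step_odd:
  assumes odd: "odd (Suc k)" and rep: "represents (Suc k) p" and inv: "inv_odd (Suc k) c p"
  shows "\<exists>p'. represents (Suc (Suc k)) p' \<and> inv_even (Suc (Suc k)) (fact k * c) p'"
proof -
  define f where "f = (\<lambda>m. coeff (p m) ((m - 1) div 2))"
  have p0: "p 0 = 0" and p3: "p 3 = smult c [:of_nat (2 * Suc k + 5), 3:]"
    and f: "top_coeff ((m - 1) div 2) (f m) (p m)" for m
    using inv by (auto simp: inv_odd_def f_def intro: top_coeffI)
  have sg: "(-1) ^ Suc k = (-1 :: rat)" using odd by simp
  have "p 3 \<circ>\<^sub>p [:-1, 1:] = smult c [:of_nat (2 * k + 4), 3:]"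
    unfolding p3 by (simp add: pcompose_pCons algebra_simps)
  then have "[:of_nat (2 * k + 4), 3:] * [:fact k * c:] = smult (fact k) (rec_poly (Suc k) p 0)"
    by (simp add: rec_poly_def shift_poly_def p0 sg kap_nat_def del: power_Suc)
  then obtain p' where p'0: "p' 0 = [:fact k * c:]" and rep': "represents (Suc (Suc k)) p'"
    and L1: "\<And>m. [:of_nat (m + 2 * k + 4), 3:] * p' m = smult (fact k) (rec_poly (Suc k) p m)"
    and L2: "\<And>m. m > 0 \<Longrightarrow> [:of_nat (2 * m + 2 * k + 4), 3:] * p' m = smult (fact k) (rec_poly' (Suc k) p m)"
    using rec_step[OF rep] by metis
  \<comment> \<open>The top coefficient of \<open>eps_poly (Suc k) m\<close>. For odd n it is the
    opposite choice to \<open>kap_nat m\<close>, so a shift of m by 3 exchanges the two.\<close>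
  define w where "w = (\<lambda>m::nat. if even m then 2 else 1 :: rat)"
  have main: "top_coeff (m div 2 + 1) (w m * f m) ([:a, 1:] * eps_poly (Suc k) m * p m)" if "m > 0" for m a
  proof (cases "even m")
    case True
    then have "eps_poly (Suc k) m = [:of_nat (m + Suc k + 1), 2:]" using odd by (simp add: eps_poly_def)
    moreover have "top_coeff (1 + 1 + (m - 1) div 2) (1 * 2 * f m) ([:a, 1:] * [:of_nat (m + Suc k + 1), 2:] * p m)"
      by (intro top_coeff_mult top_coeff_linear f)
    moreover have "1 + 1 + (m - 1) div 2 = m div 2 + 1" using True that by (auto elim!: evenE)
    ultimately show ?thesis using True by (simp add: w_def del: mult_pCons_left)
  next
    case False
    then have "eps_poly (Suc k) m = [:1:]" using odd by (simp add: eps_poly_def)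
    moreover have "top_coeff (1 + 0 + (m - 1) div 2) (1 * 1 * f m) ([:a, 1:] * [:1:] * p m)"
      by (intro top_coeff_mult top_coeff_linear top_coeff_const f)
    moreover have "1 + 0 + (m - 1) div 2 = m div 2 + 1" using False by (auto elim!: oddE)
    ultimately show ?thesis using False by (simp add: w_def del: mult_pCons_left)
  qed
  have top': "top_coeff (m div 2) (fact k * b / 3) (p' m)" if "top_coeff (m div 2 + 1) b (rec_poly (Suc k) p m)" for m b
    by (rule top_coeff_div[OF L1]) (use top_coeff_smult[OF that] in auto)
  have top2: "top_coeff (m div 2) (fact k * (kap_nat m * f (m + 3) - w m * f m) / 3) (p' m)" if "m > 0" for m
  proof (rule top_coeff_div[OF L2[OF that]])
    have "top_coeff ((m + 3 - 1) div 2) (kap_nat m * f (m + 3)) (smult (kap_nat m) (p (m + 3) \<circ>\<^sub>p [:-1, 1:]))"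
      by (intro top_coeff_smult top_coeff_shift f)
    then have "top_coeff (m div 2 + 1) (kap_nat m * f (m + 3)) (smult (kap_nat m) (p (m + 3) \<circ>\<^sub>p [:-1, 1:]))"
      by simp
    from top_coeff_smult[OF top_coeff_diff[OF this main[OF that, of "of_nat (2 * Suc k)"]], of "fact k"]
    show "top_coeff (Suc (m div 2)) (fact k * (kap_nat m * f (m + 3) - w m * f m)) (smult (fact k) (rec_poly' (Suc k) p m))"
      unfolding rec_poly'_def by (simp del: mult_pCons_left)
  qed simp
  have top3: "top_coeff ((m + 3) div 2) (fact k * (w (m + 3) * f (m + 3) - kap_nat (m + 3) * f m) / 3) (p' (m + 3))" for m
  proof (rule top')
    have "top_coeff ((m + 3) div 2 + 1) (f m) (shift_poly (Suc k) p (m + 3))"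
    proof (cases "m = 0")
      case True
      then show ?thesis by (simp add: shift_poly_def p0 f_def top_coeff_zero)
    next
      case False
      have "top_coeff (1 + 1 + 1 + (m - 1) div 2) (1 * 1 * 1 * f m) ([:1, 1:] * [:2, 1:] * [:of_nat (m + 3), 1:] * (p m \<circ>\<^sub>p [:2, 1:]))"
        by (intro top_coeff_mult top_coeff_linear top_coeff_shift f)
      moreover have "1 + 1 + 1 + (m - 1) div 2 = (m + 3) div 2 + 1" using False by (cases m) auto
      ultimately show ?thesis by (simp add: shift_poly_def del: mult_pCons_left)
    qed
    then show "top_coeff ((m + 3) div 2 + 1) (w (m + 3) * f (m + 3) - kap_nat (m + 3) * f m) (rec_poly (Suc k) p (m + 3))"
      unfolding rec_poly_def by (intro top_coeff_smult top_coeff_diff main) auto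
  qed
  \<comment> \<open>The shifted term for m = 1 involves \<open>p 2\<close> and that for m = 2
    involves \<open>p 1\<close>, each negated by antisymmetry; both cases therefore yield the same
    number.\<close>
  have t1: "top_coeff 0 (fact k * (f 1 + 2 * f 2) / 3) (p' 1)"
  proof -
    have "top_coeff (1 + 0) (1 * f 2) ([:1, 1:] * p 2)"
      using f[of 2] by (intro top_coeff_mult top_coeff_linear) simp
    then have "top_coeff 1 (- 1 * f 2) (shift_poly (Suc k) p 1)"
      unfolding shift_poly_def sg using top_coeff_smult[of 1 "f 2" "[:1, 1:] * p 2" "-1"] by simp
    then have "top_coeff (1 div 2 + 1) (w 1 * f 1 - kap_nat 1 * (- 1 * f 2)) (rec_poly (Suc k) p 1)"
      unfolding rec_poly_def by (intro top_coeff_smult top_coeff_diff main) auto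
    from top'[OF this] show ?thesis by (simp add: w_def kap_nat_def)
  qed
  have t2: "top_coeff 1 (fact k * (2 * f 2 + f 1) / 3) (p' 2)"
  proof -
    have "top_coeff (1 + 1 + 0) (1 * 1 * f 1) ([:1, 1:] * [:2, 1:] * (p 1 \<circ>\<^sub>p [:1, 1:]))"
      using f[of 1] by (intro top_coeff_mult top_coeff_linear top_coeff_shift) simp
    then have "top_coeff (1 + 1) (- 1 * f 1) (shift_poly (Suc k) p 2)"
      unfolding shift_poly_def sg
      using top_coeff_smult[of "1 + 1" "f 1" "[:1, 1:] * [:2, 1:] * (p 1 \<circ>\<^sub>p [:1, 1:])" "-1"]
      by (simp del: mult_pCons_left)
    then have "top_coeff (2 div 2 + 1) (w 2 * f 2 - kap_nat 2 * (- 1 * f 1)) (rec_poly (Suc k) p 2)"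
      unfolding rec_poly_def by (intro top_coeff_smult top_coeff_diff main) auto
    from top'[OF this] show ?thesis by (simp add: w_def kap_nat_def)
  qed
  \<comment> \<open>An exact formula is kept because \<open>p' 0\<close> and \<open>p' 3\<close>
    decide the case m = 0 of the next step.\<close>
  have p'3: "p' 3 = smult (fact k * c) [:of_nat (2 * Suc (Suc k) + 1), 1:]"
  proof -
    have "rec_poly (Suc k) p 3 = [:of_nat (3 + 2 * Suc k), 1:] * [:1:] * smult c [:of_nat (2 * Suc k + 5), 3:]"
      using odd by (simp add: rec_poly_def eps_poly_def shift_poly_def p0 p3)
    then have "[:of_nat (3 + 2 * k + 4), 3:] * p' 3 =
       [:of_nat (3 + 2 * k + 4), 3:] * smult (fact k * c) [:of_nat (2 * Suc (Suc k) + 1), 1:]"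
      unfolding L1 by (simp add: algebra_simps)
    then show ?thesis by (subst (asm) mult_left_cancel) simp_all
  qed
  have deg: "degree (p' m) \<le> m div 2" for m
  proof (cases "m = 0")
    case True
    then show ?thesis by (simp add: p'0)
  next
    case False
    then show ?thesis using top2[of m] by (simp add: top_coeff_def)
  qed
  have per: "coeff (p' (m + 3)) ((m + 3) div 2) = coeff (p' m) (m div 2)" for m
  proof (cases "m = 0")
    case True
    then show ?thesis using p'0 p'3 by simp
  next
    case False
    then have "coeff (p' m) (m div 2) = fact k * (kap_nat m * f (m + 3) - w m * f m) / 3"
      using top2[of m] by (simp add: top_coeff_def)
    moreover have "coeff (p' (m + 3)) ((m + 3) div 2) = fact k * (w (m + 3) * f (m + 3) - kap_nat (m + 3) * f m) / 3"
      using top3[of m] by (simp add: top_coeff_def)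
    moreover have "w (m + 3) = kap_nat m" "kap_nat (m + 3) = w m" by (simp_all add: w_def kap_nat_def)
    ultimately show ?thesis by simp
  qed
  have "coeff (p' 1) 0 = coeff (p' 2) 1"
    using t1 t2 by (simp add: top_coeff_def add.commute)
  then show ?thesis
    using rep' p'0 p'3 deg per by (auto simp: inv_even_def)
qed

text \<open>For m = 0 the two terms of \<open>rec_poly\<close> cancel, by the prescribed
  \<open>p 0\<close> and \<open>p 3\<close>. For m > 0 the periodicity gives them equal top
  coefficients, so the degree bound drops by one before division by the linear factor lowers it
  again.\<close>

lemma step_even:
  assumes even: "even (Suc k)" and rep: "represents (Suc k) p" and inv: "inv_even (Suc k) c p"
  shows "\<exists>p'. represents (Suc (Suc k)) p' \<and> inv_odd (Suc (Suc k)) (fact k * c * of_nat (Suc k)) p'"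
proof -
  define e where "e = (\<lambda>m. coeff (p m) (m div 2))"
  have p0: "p 0 = [:c:]" and p3: "p 3 = smult c [:of_nat (2 * Suc k + 1), 1:]"
    and e: "top_coeff (m div 2) (e m) (p m)" and e3: "e (m + 3) = e m" and e12: "e 2 = e 1" for m
    using inv by (auto simp: inv_even_def e_def intro: top_coeffI)
  have sg: "(-1) ^ Suc k = (1 :: rat)" using even by simp
  have "p 3 \<circ>\<^sub>p [:-1, 1:] = smult c [:of_nat (2 * Suc k), 1:]"
    unfolding p3 by (simp add: pcompose_pCons algebra_simps)
  moreover have "eps_poly (Suc k) 0 = [:1:]" using even by (simp add: eps_poly_def)
  ultimately have "rec_poly (Suc k) p 0 = 0"
    by (simp add: rec_poly_def shift_poly_def p0 sg kap_nat_def algebra_simps del: power_Suc)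
  then have "[:of_nat (2 * k + 4), 3:] * 0 = smult (fact k) (rec_poly (Suc k) p 0)"
    by simp
  then obtain p' where p'0: "p' 0 = 0" and rep': "represents (Suc (Suc k)) p'"
    and L1: "\<And>m. [:of_nat (m + 2 * k + 4), 3:] * p' m = smult (fact k) (rec_poly (Suc k) p m)"
    using rec_step[OF rep] by metis
  have deg: "degree (p' m) \<le> (m - 1) div 2" for m
  proof (cases "m = 0")
    case True
    then show ?thesis by (simp add: p'0)
  next
    case False
    have main: "top_coeff (Suc (Suc ((m - 1) div 2))) (kap_nat m * e m) ([:of_nat (m + 2 * Suc k), 1:] * eps_poly (Suc k) m * p m)"
    proof (cases "even m")
      case True
      then have "eps_poly (Suc k) m = [:1:]" using even by (simp add: eps_poly_def)
      moreover have "top_coeff (1 + 0 + m div 2) (1 * 1 * e m) ([:of_nat (m + 2 * Suc k), 1:] * [:1:] * p m)"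
        by (intro top_coeff_mult top_coeff_linear top_coeff_const e)
      moreover have "1 + 0 + m div 2 = Suc (Suc ((m - 1) div 2))" using True False by (auto elim!: evenE)
      ultimately show ?thesis using True by (simp add: kap_nat_def del: mult_pCons_left)
    next
      case False
      then have "eps_poly (Suc k) m = [:of_nat (m + Suc k + 1), 2:]" using even by (simp add: eps_poly_def)
      moreover have "top_coeff (1 + 1 + m div 2) (1 * 2 * e m) ([:of_nat (m + 2 * Suc k), 1:] * [:of_nat (m + Suc k + 1), 2:] * p m)"
        by (intro top_coeff_mult top_coeff_linear e)
      moreover have "1 + 1 + m div 2 = Suc (Suc ((m - 1) div 2))" using False by (auto elim!: oddE)
      ultimately show ?thesis using False by (simp add: kap_nat_def del: mult_pCons_left)
    qed
    \<comment> \<open>The top coefficients that appear are \<open>e 2\<close>, \<open>e 1\<close>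
      and \<open>e q\<close> with \<open>m = q + 3\<close>; the invariant identifies each with
      \<open>e m\<close>.\<close>
    have shift: "top_coeff (Suc (Suc ((m - 1) div 2))) (e m) (shift_poly (Suc k) p m)"
    proof -
      consider "m = 1" | "m = 2" | q where "m = q + 3"
      proof -
        have "m = 1 \<or> m = 2 \<or> m = (m - 3) + 3" using False by linarith
        then show ?thesis using that by metis
      qed
      then show ?thesis
      proof cases
        case 1
        have "top_coeff (1 + 1) (1 * e 2) ([:1, 1:] * p 2)"
          using e[of 2] by (intro top_coeff_mult top_coeff_linear) simp
        then show ?thesis unfolding shift_poly_def sg 1 using e12 by (simp add: numeral_2_eq_2 del: mult_pCons_left)
      next
        case 2
        have "top_coeff (1 + 1 + 0) (1 * 1 * e 1) ([:1, 1:] * [:2, 1:] * (p 1 \<circ>\<^sub>p [:1, 1:]))"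
          using e[of 1] by (intro top_coeff_mult top_coeff_linear top_coeff_shift) simp
        then show ?thesis unfolding shift_poly_def sg 2 using e12 by (simp add: numeral_2_eq_2 del: mult_pCons_left)
      next
        case 3
        have "top_coeff (1 + 1 + 1 + q div 2) (1 * 1 * 1 * e q) ([:1, 1:] * [:2, 1:] * [:of_nat m, 1:] * (p q \<circ>\<^sub>p [:2, 1:]))"
          by (intro top_coeff_mult top_coeff_linear top_coeff_shift e)
        moreover have "1 + 1 + 1 + q div 2 = Suc (Suc ((m - 1) div 2))" using 3 by simp
        moreover have "e q = e m" using 3 e3 by simp
        ultimately show ?thesis using 3 by (simp add: shift_poly_def del: mult_pCons_left)
      qed
    qed
    have "top_coeff (Suc (Suc ((m - 1) div 2))) (fact k * (kap_nat m * e m - kap_nat m * e m)) (smult (fact k) (rec_poly (Suc k) p m))"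
      unfolding rec_poly_def by (intro top_coeff_smult top_coeff_diff main shift)
    then have "degree (smult (fact k) (rec_poly (Suc k) p m)) \<le> Suc ((m - 1) div 2)"
      by (intro top_coeff_degree_drop) simp
    then show ?thesis by (rule degree_div[OF L1, rotated]) simp
  qed
  have p'3: "p' 3 = smult (fact k * c * of_nat (Suc k)) [:of_nat (2 * Suc (Suc k) + 5), 3:]"
  proof -
    have "rec_poly (Suc k) p 3 = [:of_nat (3 + 2 * Suc k), 1:] * [:of_nat (3 + Suc k + 1), 2:] * smult c [:of_nat (2 * Suc k + 1), 1:]
       - smult 2 ([:1, 1:] * [:2, 1:] * [:3, 1:] * [:c:])"
      using even by (simp add: rec_poly_def eps_poly_def shift_poly_def kap_nat_def p0 p3)
    then have "[:of_nat (3 + 2 * k + 4), 3:] * p' 3 =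
       [:of_nat (3 + 2 * k + 4), 3:] * smult (fact k * c * of_nat (Suc k)) [:of_nat (2 * Suc (Suc k) + 5), 3:]"
      unfolding L1 by (simp add: algebra_simps)
    then show ?thesis by (subst (asm) mult_left_cancel) simp_all
  qed
  show ?thesis
    using rep' p'0 p'3 deg by (auto simp: inv_odd_def)
qed

lemma ex_represents:
  "\<exists>p c. represents (Suc k) p \<and> (if even (Suc k) then inv_even (Suc k) c p else inv_odd (Suc k) c p)"
proof (induction k)
  case 0
  then show ?case using represents_base inv_odd_base by auto
next
  case (Suc k)
  then obtain p c where rep: "represents (Suc k) p"
    and inv: "if even (Suc k) then inv_even (Suc k) c p else inv_odd (Suc k) c p" by blast
  show ?case
  proof (cases "even (Suc k)")
    case True
    then show ?thesis using step_even[OF True rep, of c] inv by auto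
  next
    case False
    then show ?thesis using step_odd[OF False rep, of c] inv by auto
  qed
qed

section \<open>Return to the product formula of the theorem\<close>

lemma poch_of_nat: "poch (int a) n = pochhammer (of_nat a) n"
  by (simp add: poch_def)

lemma W_nat:
  "W (int x) (int x + int m) (Suc k) =
     (\<Prod>i\<in>{1..k}. (fact (2 * x + m + i) * pochhammer (of_nat (3 * x + m + 2 * i + 2)) i
        * pochhammer (of_nat (3 * x + 2 * m + 2 * i + 2)) i) / (fact (x + 2 * i) * fact (x + m + 2 * i)))
     * fact (2 * x + m) * h (Suc k) (int (2 * x + m))"
proof -
  define g where "g = (\<lambda>i. (fact (2 * x + m + i) * pochhammer (of_nat (3 * x + m + 2 * i + 2)) i
        * pochhammer (of_nat (3 * x + 2 * m + 2 * i + 2)) i) :: rat)"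
  have g: "ifact (int x + (int x + int m) + int i) * poch (2 * int x + (int x + int m) + 2 * int i + 2) i
     * poch (int x + 2 * (int x + int m) + 2 * int i + 2) i = g i" for i
  proof -
    have "int x + (int x + int m) + int i = int (2 * x + m + i)"
      "2 * int x + (int x + int m) + 2 * int i + 2 = int (3 * x + m + 2 * i + 2)"
      "int x + 2 * (int x + int m) + 2 * int i + 2 = int (3 * x + 2 * m + 2 * i + 2)" by simp_all
    then show ?thesis by (simp only: g_def ifact_nat poch_of_nat)
  qed
  have rfact: "rfact (int x + 2 * int i) * rfact (int x + int m + 2 * int i) = 1 / (fact (x + 2 * i) * fact (x + m + 2 * i))" for i
  proof -
    have "int x + 2 * int i = int (x + 2 * i)" "int x + int m + 2 * int i = int (x + m + 2 * i)" by simp_all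
    then show ?thesis by (simp only: rfact_nat) simp
  qed
  have s: "int x + (int x + int m) = int (2 * x + m)" by simp
  \<comment> \<open>The factor for i = 0 is just (2x+m)!, since its Pochhammer symbols are
    empty.\<close>
  have "{..<Suc k} = insert 0 {1..k}" "{1..<Suc k} = {1..k}" by auto
  then show ?thesis
    unfolding W_def g rfact unfolding s
    by (simp add: g_def prod_dividef prod.distrib)
qed

text \<open>For even m the product in \<open>h\<close> has \<open>(n + 1) div 2\<close> factors; if
  n is odd, the last of them lies beyond the product here and equals 2x+m+n.\<close>

lemma h_nat:
  "h n (int (2 * x + m)) = (\<Prod>i<n div 2. of_nat (2 * x + 2 * ((m + 1) div 2) + 2 * i + 1))
     * (if odd n \<and> even m then of_nat (2 * x + m + n) else 1) / fact (x + m div 2)"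
proof (cases "even m")
  case True
  then obtain q where q: "m = 2 * q" by blast
  have e: "int (2 * x + m) + 1 + 2 * int i = int (2 * x + 2 * ((m + 1) div 2) + 2 * i + 1)" for i
    using q by simp
  have ifact: "ifact (int (2 * x + m) div 2) = fact (x + m div 2)"
    using q by (simp add: ifact_def nat_add_distrib)
  show ?thesis
  proof (cases "even n")
    case True
    then show ?thesis using \<open>even m\<close> unfolding h_def e ifact by (auto elim!: evenE)
  next
    case False
    then obtain l where "n = 2 * l + 1" by (auto elim: oddE)
    then show ?thesis using \<open>even m\<close> unfolding h_def e ifact by (auto simp: q ac_simps)
  qed
next
  case False
  then obtain q where q: "m = 2 * q + 1" by (auto elim: oddE)
  have e: "int (2 * x + m) + 2 + 2 * int i = int (2 * x + 2 * ((m + 1) div 2) + 2 * i + 1)" for i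
    using q by simp
  have ifact: "ifact (int (2 * x + m) div 2) = fact (x + m div 2)"
    using q by (simp add: ifact_def nat_add_distrib)
  show ?thesis using False unfolding h_def e ifact by simp
qed

theorem theorem2:
  fixes m n :: nat
  assumes "m \<le> n" and "n \<ge> 1"
  shows "\<exists>P :: rat poly. degree P \<le> m div 2 \<and>
    (\<forall>x :: nat.
       of_int (D (int x) (int x + int m) n) =
         (\<Prod>i\<in>{1..n-1}.
            (fact (2*x+m+i) * pochhammer (of_nat (3*x+m+2*i+2)) i
               * pochhammer (of_nat (3*x+2*m+2*i+2)) i)
            / (fact (x+2*i) * fact (x+m+2*i)))
         * (fact (2*x+m) / (fact (x + m div 2) * fact (x+m)))
         * (\<Prod>i<n div 2. of_nat (2*x + 2*((m+1) div 2) + 2*i + 1))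
         * poly P (of_nat x)) \<and>
    (odd n \<and> even m \<longrightarrow> [:of_nat (m+n), 2:] dvd P)"
proof -
  obtain k where k: "n = Suc k" using assms(2) by (cases n) auto
  obtain p c where rep: "represents n p"
    and inv: "if even n then inv_even n c p else inv_odd n c p"
    using ex_represents[of k] k by blast
  \<comment> \<open>The extra factor from \<open>h_nat\<close> is not part of the stated product and
    goes into the polynomial.\<close>
  define Q where "Q = (if odd n \<and> even m then [:of_nat (m + n), 2:] * p m else p m)"
  have "degree Q \<le> m div 2"
  proof (cases "even n")
    case True
    then show ?thesis using inv by (simp add: Q_def inv_even_def)
  next
    case False
    then have deg: "degree (p m) \<le> (m - 1) div 2" and p0: "p 0 = 0"
      using inv by (auto simp: inv_odd_def)
    \<comment> \<open>If m is even and positive, the sharper bound for odd n leaves room for the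
      linear factor; for m = 0 the polynomial is zero.\<close>
    show ?thesis
    proof (cases "even m \<and> m > 0")
      case True
      have "degree ([:of_nat (m + n), 2:] * p m) \<le> 1 + (m - 1) div 2"
        by (rule order_trans[OF degree_mult_le]) (use deg in \<open>auto intro: add_mono\<close>)
      also have "\<dots> = m div 2" using True by (auto elim!: evenE)
      finally show ?thesis using True False by (simp add: Q_def)
    next
      case neg: False
      then show ?thesis
      proof (cases "m = 0")
        case True
        then show ?thesis using p0 by (simp add: Q_def)
      next
        case False
        then show ?thesis using neg deg by (simp add: Q_def)
      qed
    qed
  qed
  moreover have "odd n \<and> even m \<longrightarrow> [:of_nat (m + n), 2:] dvd Q"
    by (simp add: Q_def del: mult_pCons_left)
  moreover have "of_int (D (int x) (int x + int m) n) =
         (\<Prod>i\<in>{1..n-1}.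
            (fact (2*x+m+i) * pochhammer (of_nat (3*x+m+2*i+2)) i
               * pochhammer (of_nat (3*x+2*m+2*i+2)) i)
            / (fact (x+2*i) * fact (x+m+2*i)))
         * (fact (2*x+m) / (fact (x + m div 2) * fact (x+m)))
         * (\<Prod>i<n div 2. of_nat (2*x + 2*((m+1) div 2) + 2*i + 1))
         * poly Q (of_nat x)" for x
  proof -
    define G where "G = (\<Prod>i\<in>{1..n-1}.
            (fact (2*x+m+i) * pochhammer (of_nat (3*x+m+2*i+2)) i
               * pochhammer (of_nat (3*x+2*m+2*i+2)) i)
            / (fact (x+2*i) * fact (x+m+2*i)) :: rat)"
    define H where "H = (\<Prod>i<n div 2. of_nat (2*x + 2*((m+1) div 2) + 2*i + 1) :: rat)"
    define t where "t = (if odd n \<and> even m then of_nat (2 * x + m + n) else 1 :: rat)"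
    have Q: "poly Q (of_nat x) = t * poly (p m) (of_nat x)"
      by (auto simp: Q_def t_def algebra_simps)
    have "W (int x) (int x + int m) n = G * fact (2 * x + m) * (H * t / fact (x + m div 2))"
      unfolding k W_nat h_nat unfolding G_def H_def t_def k by simp
    moreover have "R n (int x) (int x + int m) = poly (p m) (of_nat x) / fact (x + m)"
      using representsD[OF rep, of x m] by (simp add: field_simps)
    moreover have "of_int (D (int x) (int x + int m) n) = R n (int x) (int x + int m) * W (int x) (int x + int m) n"
      using W_pos[of "int x" "int x + int m" n] of_int_D[of "int x" "int x + int m" n] by (simp add: R_def)
    ultimately have "of_int (D (int x) (int x + int m) n) =
       G * (fact (2 * x + m) / (fact (x + m div 2) * fact (x + m))) * H * (t * poly (p m) (of_nat x))"
      by (simp add: ac_simps)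
    then show ?thesis unfolding Q G_def H_def .
  qed
  ultimately show ?thesis by blast
qed

end
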